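(* For real $x>1$ let $f_x$ be the totally multiplicative function on positive integers with $f_x(p)=\rho\!\left(\frac{\log p}{\log x}\right)$ for every prime $p$. Then for every $u>0$, $$\Pi(u)=\lim_{x\to\infty}\frac1{x^u}\sum_{n\le x^u}f_x(n).$$
   Context: $\rho$ is the Dickman function: the unique continuous function on $[0,\infty)$ with $\rho=1$ on $[0,1]$ and $u\rho'(u)+\rho(u-1)=0$ for $u>1$. $\Pi:(0,\infty)\to[0,1]$ is the function with $\Pi(u)=1$ for $u\in(0,1]$ and $\Pi(u)=\frac1u\int_0^u\Pi(t)\rho(u-t)\,dt$ for $u>1$ (with $\Pi(0)=1$). *)

theory Defs
  imports "HOL-Analysis.Analysis" "HOL-Computational_Algebra.Primes"
begin

text \<open>Dickman function: the unique continuous function on [0,inf) with rho = 1 on [0,1]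
  and u rho'(u) + rho(u-1) = 0 for u > 1. Values on negative arguments are normalised to 0
  (standard convention) so that the description is unique.\<close>
definition dickman_rho :: "real \<Rightarrow> real" where
  "dickman_rho = (THE \<rho>. continuous_on {0..} \<rho>
      \<and> (\<forall>u\<in>{0..1}. \<rho> u = 1)
      \<and> (\<forall>u>1. \<exists>D. (\<rho> has_real_derivative D) (at u) \<and> u * D + \<rho> (u - 1) = 0)
      \<and> (\<forall>u<0. \<rho> u = 0))"

definition Pi_fun :: "real \<Rightarrow> real" where
  "Pi_fun = (THE P. (\<forall>u\<ge>0. 0 \<le> P u \<and> P u \<le> 1)
      \<and> P 0 = 1
      \<and> (\<forall>u\<in>{0<..1}. P u = 1)
      \<and> (\<forall>u>1. (\<lambda>t. P t * dickman_rho (u - t)) integrable_on {0..u}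
              \<and> P u = (1 / u) * integral {0..u} (\<lambda>t. P t * dickman_rho (u - t)))
      \<and> (\<forall>u<0. P u = 0))"

definition f_mult :: "real \<Rightarrow> nat \<Rightarrow> real" where
  "f_mult x n = (\<Prod>p\<in>prime_factors n. dickman_rho (ln (real p) / ln x) ^ multiplicity p n)"

end

theory Submission
  imports Defs "HOL-Number_Theory.Prime_Powers"
begin

text \<open>Write \<open>F(u)\<close> for the mean value of \<open>f_x\<close> up to \<open>x\<^sup>u\<close>. Expanding \<open>\<Sum> f_x(n) ln n\<close> by
  \<open>ln n = \<Sum>\<^bsub>d|n\<^esub> \<Lambda>(d)\<close> gives, with \<open>t(d) = ln d / ln x\<close>,
  \<open>u F(u) = (1 / ln x) \<Sum> \<Lambda>(d)/d \<rho>(t(d)) F(u - t(d)) + O(1 / ln x)\<close>. Because the weights are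
  \<open>\<Lambda>(d)/d\<close> rather than \<open>\<Lambda>(d)\<close>, Mertens' first theorem (and not the prime number theorem) is
  enough to see that they approximate Lebesgue measure in the variable \<open>t(d)\<close>. The solution \<open>\<Pi>\<close>
  of the limiting equation is continuous, so it satisfies the same discrete equation up to a small
  error, and only the regularity of \<open>\<Pi>\<close>, never that of \<open>F\<close>, is needed. The difference
  \<open>E = \<bar>F - \<Pi>\<bar>\<close> is negligible on \<open>[\<eta>,1]\<close> for each \<open>\<eta> > 0\<close>, and weights with \<open>u - t(d) \<ge> 1\<close> have total mass about
  \<open>u - 1\<close>; hence \<open>M = sup\<^bsub>[1,U]\<^esub> E\<close> satisfies \<open>M \<le> o(1) + (1 - 1/U) M\<close>.
  The same contraction factor yields existence and uniqueness of \<open>\<Pi>\<close>.\<close>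

section \<open>Chebyshev and Mertens estimates\<close>

lemma sum_divisors_swap:
  fixes h :: "nat \<Rightarrow> nat \<Rightarrow> 'a::comm_monoid_add"
  shows "(\<Sum>n=1..N. \<Sum>d | d dvd n. h d (n div d)) = (\<Sum>d=1..N. \<Sum>m=1..N div d. h d m)"
proof -
  have fin: "finite {d. d dvd n}" if "n \<in> {1..N}" for n
    using that by (intro finite_divisors_nat) auto
  have "(\<Sum>n=1..N. \<Sum>d | d dvd n. h d (n div d))
      = (\<Sum>(n, d)\<in>(SIGMA n:{1..N}. {d. d dvd n}). h d (n div d))"
    using fin by (subst sum.Sigma) auto
  also have "\<dots> = (\<Sum>(d, m)\<in>(SIGMA d:{1..N}. {1..N div d}). h d m)"
  proof (rule sum.reindex_bij_witness[of _ "\<lambda>(d, m). (d * m, d)" "\<lambda>(n, d). (d, n div d)"], goal_cases)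
    case (2 a)
    then show ?case
    proof -
      obtain n d where a: "a = (n, d)" by (cases a)
      with 2 have "n \<ge> 1" "n \<le> N" "d dvd n" by auto
      then have "d \<ge> 1" "d \<le> N" "n div d \<ge> 1" "n div d \<le> N div d"
        by (auto simp: Suc_le_eq dvd_pos_nat div_greater_zero_iff div_le_mono
            intro: order_trans[OF dvd_imp_le] dvd_imp_le)
      then show ?thesis using a by auto
    qed
  next
    case (4 b)
    obtain d m where b: "b = (d, m)" by (cases b)
    with 4 have *: "d \<ge> 1" "m \<ge> 1" "m \<le> N div d" by auto
    then have "d * m \<le> d * (N div d)" by simp
    also have "\<dots> \<le> N" by simp
    finally show ?case using b * by auto
  qed auto
  also have "\<dots> = (\<Sum>d=1..N. \<Sum>m=1..N div d. h d m)"
    by (subst sum.Sigma) auto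
  finally show ?thesis .
qed

text \<open>Complete multiplicativity lets f(n) split as f(d) f(n/d) for every divisor d, so ln =
  \<open>\<Lambda>\<close> * 1 becomes (f ln) = (f \<open>\<Lambda>\<close>) * f. This is the source
  of the recursion for the mean of f; the case f = 1 gives the factorial identity behind Chebyshev
  and Mertens.\<close>

lemma sum_completely_multiplicative_ln:
  fixes f :: "nat \<Rightarrow> real"
  assumes mult: "\<And>m n. m > 0 \<Longrightarrow> n > 0 \<Longrightarrow> f (m * n) = f m * f n"
  shows "(\<Sum>n=1..N. f n * ln (real n))
       = (\<Sum>d=1..N. mangoldt d * f d * (\<Sum>m=1..N div d. f m))"
proof -
  have "(\<Sum>n=1..N. f n * ln (real n)) = (\<Sum>n=1..N. \<Sum>d | d dvd n. mangoldt d * f d * f (n div d))"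
  proof (rule sum.cong[OF refl])
    fix n assume n: "n \<in> {1..N}"
    then have "f n * ln (real n) = f n * (\<Sum>d | d dvd n. mangoldt d)"
      by (subst mangoldt_sum) auto
    also have "\<dots> = (\<Sum>d | d dvd n. mangoldt d * f d * f (n div d))"
      unfolding sum_distrib_left
    proof (rule sum.cong[OF refl])
      fix d assume "d \<in> {d. d dvd n}"
      then obtain m where "n = d * m" by auto
      with n show "f n * mangoldt d = mangoldt d * f d * f (n div d)"
        using mult[of d m] by auto
    qed
    finally show "f n * ln (real n) = (\<Sum>d | d dvd n. mangoldt d * f d * f (n div d))" .
  qed
  also have "\<dots> = (\<Sum>d=1..N. \<Sum>m=1..N div d. mangoldt d * f d * f m)"
    by (rule sum_divisors_swap)
  finally show ?thesis by (simp add: sum_distrib_left)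
qed

section \<open>Elementary bounds for ln N! and for sums of the von Mangoldt function\<close>

lemma ln_fact_eq_sum: "ln (fact N :: real) = (\<Sum>n=1..N. ln (real n))"
  by (induction N) (auto simp: ln_mult)

lemma ln_fact_eq_sum_mangoldt:
  "ln (fact N :: real) = (\<Sum>d=1..N. mangoldt d * real (N div d))"
  using sum_completely_multiplicative_ln[of "\<lambda>_. 1" N] by (simp add: ln_fact_eq_sum)

lemma ln_fact_le: "ln (fact N :: real) \<le> real N * ln (real N)"
proof -
  have "(\<Sum>n=1..N. ln (real n)) \<le> (\<Sum>n=1..N. ln (real N))"
    by (intro sum_mono) auto
  then show ?thesis by (simp add: ln_fact_eq_sum)
qed

text \<open>A weak Stirling bound: since N (ln(N+1) - ln N) <= 1, the unit by which the subtracted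
  term grows pays for each induction step.\<close>

lemma ln_fact_ge: "real N * ln (real N) - real N \<le> ln (fact N :: real)"
proof (induction N)
  case (Suc N)
  show ?case
  proof (cases "N = 0")
    case False
    have "ln (1 + 1 / real N) \<le> 1 / real N"
      using False by (intro ln_add_one_self_le_self) auto
    moreover have "1 + 1 / real N = real (Suc N) / real N"
      using False by (simp add: field_simps)
    ultimately have "ln (real (Suc N)) - ln (real N) \<le> 1 / real N"
      using False by (simp add: ln_div)
    then have "real N * ln (real (Suc N)) - real N * ln (real N) \<le> 1"
      using False by (simp add: field_simps)
    moreover have "ln (fact (Suc N) :: real) = ln (real (Suc N)) + ln (fact N)"
      by (simp only: fact_Suc of_nat_mult ln_mult_pos of_nat_0_less_iff zero_less_Suc fact_gt_zero)
    ultimately show ?thesis using Suc.IH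
      by (simp add: algebra_simps)
  qed auto
qed auto

text \<open>Chebyshev's argument: the logarithm of the central binomial coefficient is at most 2m ln
  2, and it is the \<open>\<Lambda>\<close>-weighted sum of floor(2m/d) - 2 floor(m/d). These
  coefficients are nonnegative, and at least 1 for m < d <= 2m.\<close>

lemma chebyshev_psi_double:
  "(\<Sum>d=1..2 * m. mangoldt d) - (\<Sum>d=1..m. mangoldt d :: real) \<le> 2 * real m * ln 2"
proof -
  let ?A = "\<Sum>d=1..2 * m. mangoldt d * (real (2 * m div d) - 2 * real (m div d))"
  \<comment> \<open>The added terms have d > m, hence \<open>m div d = 0\<close>; both factorial
    identities can then be read over the same range.\<close>
  have "(\<Sum>d=1..2 * m. mangoldt d * real (m div d)) = (\<Sum>d=1..m. mangoldt d * real (m div d))"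
    by (rule sum.mono_neutral_right) auto
  then have A: "?A = ln (fact (2 * m)) - 2 * ln (fact m)"
    unfolding ln_fact_eq_sum_mangoldt right_diff_distrib sum_subtractf mult.left_commute[of _ 2]
      sum_distrib_left[symmetric] by simp
  have "real (fact (2 * m)) = real (fact m * fact m * (2 * m choose m))"
    using binomial_fact_lemma[of m "2 * m"] by (simp add: mult_2)
  also have "\<dots> \<le> fact m * fact m * 2 ^ (2 * m)"
  proof -
    have "(2 * m choose m) \<le> 2 ^ (2 * m)" by (rule binomial_le_pow2)
    then have "real (2 * m choose m) \<le> 2 ^ (2 * m)"
      by (metis of_nat_le_iff of_nat_numeral of_nat_power)
    then show ?thesis by (simp add: mult_left_mono)
  qed
  finally have "ln (fact (2 * m) :: real) \<le> ln (fact m * fact m * 2 ^ (2 * m))"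
    by (subst ln_le_cancel_iff) auto
  also have "\<dots> = 2 * ln (fact m) + 2 * real m * ln 2"
    by (simp add: ln_mult ln_realpow)
  finally have "?A \<le> 2 * real m * ln 2" using A by simp
  moreover have "(\<Sum>d=1..2 * m. mangoldt d) - (\<Sum>d=1..m. mangoldt d :: real) \<le> ?A"
  proof -
    have "(\<Sum>d=1..2 * m. mangoldt d) - (\<Sum>d=1..m. mangoldt d :: real) = (\<Sum>d=m+1..2 * m. mangoldt d)"
      using sum.ub_add_nat[of 1 m "mangoldt :: nat \<Rightarrow> real" m] by (simp add: mult_2)
    also have "\<dots> \<le> (\<Sum>d=m+1..2 * m. mangoldt d * (real (2 * m div d) - 2 * real (m div d)))"
    proof (rule sum_mono)
      fix d assume d: "d \<in> {m+1..2 * m}"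
      then have "2 * m div d \<ge> 1"
        by (simp add: div_greater_zero_iff Suc_leI)
      moreover have "m div d = 0" using d by simp
      ultimately show "(mangoldt d :: real) \<le> mangoldt d * (real (2 * m div d) - 2 * real (m div d))"
        using mult_left_mono[of 1 "real (2 * m div d)" "mangoldt d"] mangoldt_nonneg[of d] by simp
    qed
    also have "\<dots> \<le> ?A"
    proof (rule sum_mono2)
      fix d
      have "2 * (m div d) \<le> 2 * m div d"
        by (cases "d = 0") (auto simp: less_eq_div_iff_mult_less_eq)
      then have "2 * real (m div d) \<le> real (2 * m div d)" by linarith
      then show "0 \<le> mangoldt d * (real (2 * m div d) - 2 * real (m div d))"
        using mangoldt_nonneg[of d] by simp
    qed auto
    finally show ?thesis .
  qed
  ultimately show ?thesis by linarith
qed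

text \<open>Strong induction by halving: the doubling bound handles the upper half of the range and
  the induction hypothesis the lower half.\<close>

lemma chebyshev_psi_le: "(\<Sum>d=1..n. mangoldt d :: real) \<le> 4 * real n"
proof (induction n rule: less_induct)
  case (less n)
  have ln2: "ln (2::real) < 7/10" using ln2_le_25_over_36 by linarith
  consider "n \<le> 1" | "n > 1" by linarith
  then show ?case
  proof cases
    case 1
    then have "n = 0 \<or> n = 1" by auto
    then show ?thesis by auto
  next
    case 2
    \<comment> \<open>Rounding up ensures that 2m covers n. With ln 2 < 7/10 the total is at most
      5.4 m, which stays below 4n for every n > 1.\<close>
    define m where "m = (n + 1) div 2"
    have m: "n \<le> 2 * m" "2 * m \<le> n + 1" "m < n" using 2 unfolding m_def by auto
    have "(\<Sum>d=1..n. mangoldt d :: real) \<le> (\<Sum>d=1..2 * m. mangoldt d)"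
      using m by (intro sum_mono2) (auto simp: mangoldt_nonneg)
    also have "\<dots> \<le> 4 * real m + 2 * real m * ln 2"
      using chebyshev_psi_double[of m] less.IH[OF m(3)] by linarith
    also have "\<dots> \<le> 4 * real m + 2 * real m * (7/10)"
      using ln2 by (intro add_left_mono mult_left_mono) auto
    also have "\<dots> \<le> 4 * real n" using m 2 by linarith
    finally show ?thesis .
  qed
qed

text \<open>Replacing floor(n/d) by n/d in ln n! = sum of \<open>\<Lambda>(d)\<close> floor(n/d)
  costs at most the sum of \<open>\<Lambda>\<close> up to n, which Chebyshev bounds by 4n. Dividing
  by n and comparing ln n! with n ln n leaves a bounded error.\<close>

lemma mertens_nat:
  assumes "n \<ge> 1"
  shows "\<bar>(\<Sum>d=1..n. mangoldt d / real d) - ln (real n)\<bar> \<le> 4"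
proof -
  let ?A = "\<Sum>d=1..n. mangoldt d / real d :: real"
  have "ln (fact n) \<le> real n * ?A"
    unfolding ln_fact_eq_sum_mangoldt sum_distrib_left
  proof (rule sum_mono)
    fix d assume "d \<in> {1..n}"
    have "real (n div d) \<le> real n / real d" by (rule of_nat_div_le_of_nat)
    then have "mangoldt d * real (n div d) \<le> mangoldt d * (real n / real d)"
      by (rule mult_left_mono) (rule mangoldt_nonneg)
    then show "mangoldt d * real (n div d) \<le> real n * (mangoldt d / real d)"
      by (simp add: mult.commute)
  qed
  then have "real n * (ln (real n) - 1) \<le> real n * ?A"
    using ln_fact_ge[of n] by (simp add: algebra_simps)
  then have 1: "ln (real n) - 1 \<le> ?A" using assms by simp
  have "real n * ?A \<le> (\<Sum>d=1..n. mangoldt d * (real (n div d) + 1))"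
    unfolding sum_distrib_left
  proof (rule sum_mono)
    fix d assume "d \<in> {1..n}"
    have "n = n div d * d + n mod d" "n mod d < d" using \<open>d \<in> {1..n}\<close> by auto
    then have "n \<le> (n div d + 1) * d" by (simp only: add_mult_distrib)
    then have "real n \<le> real ((n div d + 1) * d)" by (simp only: of_nat_le_iff)
    then have "real n / real d \<le> real (n div d) + 1"
      using \<open>d \<in> {1..n}\<close> by (simp add: divide_le_eq distrib_right)
    then have "mangoldt d * (real n / real d) \<le> mangoldt d * (real (n div d) + 1)"
      by (rule mult_left_mono) (rule mangoldt_nonneg)
    then show "real n * (mangoldt d / real d) \<le> mangoldt d * (real (n div d) + 1)"
      by (simp add: mult.commute)
  qed
  also have "\<dots> = ln (fact n) + (\<Sum>d=1..n. mangoldt d)"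
    by (simp add: ln_fact_eq_sum_mangoldt distrib_left sum.distrib)
  also have "\<dots> \<le> real n * (ln (real n) + 4)"
    using ln_fact_le[of n] chebyshev_psi_le[of n] by (simp add: algebra_simps)
  finally have "?A \<le> ln (real n) + 4" using assms by simp
  with 1 show ?thesis by linarith
qed

text \<open>Rounding y down to an integer changes its logarithm by at most 1, which raises the
  constant from 4 to 5.\<close>

lemma mertens:
  assumes "y \<ge> 1"
  shows "\<bar>(\<Sum>d=1..nat \<lfloor>y\<rfloor>. mangoldt d / real d) - ln y\<bar> \<le> 5"
proof -
  define n where "n = nat \<lfloor>y\<rfloor>"
  have n: "n \<ge> 1" "real n \<le> y" "y < real n + 1"
    using assms unfolding n_def by (auto simp: le_nat_iff)
  have "ln (real n) \<le> ln y" using n by simp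
  moreover have "ln y \<le> ln (real n) + 1"
  proof -
    have "ln y - ln (real n) = ln (y / real n)" using n by (simp add: ln_div)
    also have "\<dots> \<le> y / real n - 1" using n assms by (intro ln_le_minus_one) auto
    also have "\<dots> \<le> 1" using n by (simp add: field_simps)
    finally show ?thesis by simp
  qed
  ultimately show ?thesis using mertens_nat[OF n(1)] unfolding n_def[symmetric] by linarith
qed

text \<open>Only prime powers with exponent at least 2 contribute. For fixed p they form a geometric
  series bounded by 2 ln p / p^2, and this is summable over p. The bound later pays for the values
  of f_x at prime powers, which \<open>\<rho>(t(d))\<close> describes only when d is prime.\<close>

lemma mangoldt_nonprime_sum_bounded:
  obtains C :: real where "C \<ge> 0"
    "\<And>N. (\<Sum>d\<in>{d\<in>{1..N}. \<not> prime d}. mangoldt d / real d) \<le> C"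
proof -
  \<comment> \<open>From ln n <= 2 n^(1/2) the summand is at most 4 n^(-3/2).\<close>
  have ev: "\<forall>\<^sub>F n in sequentially. norm (2 * ln (real n) / real n ^ 2) \<le> real n powr (1/2 - 2) * 4"
  proof (rule eventually_sequentiallyI[of 1])
    fix n :: nat assume n: "n \<ge> 1"
    have "ln (real n) \<le> real n powr (1/2) / (1/2)"
      using n by (intro ln_powr_bound) auto
    then have "norm (2 * ln (real n) / real n ^ 2) \<le> 4 * real n powr (1/2) / real n ^ 2"
      using n by (simp add: divide_right_mono)
    also have "4 * real n powr (1/2) / real n ^ 2 = 4 * real n powr (1/2) / real n powr 2"
      using n by simp
    also have "4 * real n powr (1/2) / real n powr 2 = real n powr (1/2 - 2) * 4"
      by (simp only: powr_diff times_divide_eq_left mult.commute)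
    finally show "norm (2 * ln (real n) / real n ^ 2) \<le> real n powr (1/2 - 2) * 4" .
  qed
  have summ: "summable (\<lambda>n. 2 * ln (real n) / real n ^ 2)"
    by (rule summable_comparison_test_ev[OF ev])
      (intro summable_mult2, simp add: summable_real_powr_iff)
  let ?C = "\<Sum>n. 2 * ln (real n) / real n ^ 2"
  have nn: "0 \<le> 2 * ln (real n) / real n ^ 2" for n
    by (cases "n = 0") auto
  show ?thesis
  proof (rule that[of ?C])
    show "?C \<ge> 0" by (rule suminf_nonneg[OF summ nn])
    fix N :: nat
    let ?D = "{d\<in>{1..N}. \<not> prime d}"
    let ?Q = "{2..N} \<times> {2..N}"
    have "(\<Sum>d\<in>?D. mangoldt d / real d) = (\<Sum>d\<in>{d\<in>?D. primepow d}. mangoldt d / real d)"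
      by (rule sum.mono_neutral_right) (auto simp: mangoldt_def)
    \<comment> \<open>Letting p run over all integers only enlarges the sum. The square box suffices
      because both p and k are at most p^k <= N.\<close>
    also have "\<dots> \<le> (\<Sum>(p, k)\<in>?Q. ln (real p) / real p ^ k)"
    proof (rule sum_le_included[where i = "\<lambda>(p, k). p ^ k"])
      show "\<forall>d\<in>{d\<in>?D. primepow d}. \<exists>q\<in>?Q. (case q of (p, k) \<Rightarrow> p ^ k) = d \<and>
          mangoldt d / real d \<le> (case q of (p, k) \<Rightarrow> ln (real p) / real p ^ k)"
      proof
        fix d assume d: "d \<in> {d\<in>?D. primepow d}"
        then obtain p k where pk: "prime p" "k > 0" "d = p ^ k"
          by (auto simp: primepow_def)
        have "k \<noteq> 1" using pk d by auto
        then have "k \<ge> 2" using pk by linarith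
        moreover have p2: "p \<ge> 2" using pk prime_ge_2_nat by blast
        moreover have "k < p ^ k" using p2 by (intro power_gt_expt) auto
        moreover have "p \<le> p ^ k" using pk p2 by (intro self_le_power) auto
        ultimately have "(p, k) \<in> ?Q" using d pk by auto
        with pk show "\<exists>q\<in>?Q. (case q of (p, k) \<Rightarrow> p ^ k) = d \<and>
          mangoldt d / real d \<le> (case q of (p, k) \<Rightarrow> ln (real p) / real p ^ k)"
          by (intro bexI[of _ "(p, k)"]) (auto simp: mangoldt_primepow)
      qed
    qed (auto intro!: divide_nonneg_nonneg)
    also have "\<dots> = (\<Sum>p=2..N. \<Sum>k=2..N. ln (real p) / real p ^ k)"
      by (simp add: sum.cartesian_product)
    also have "\<dots> \<le> (\<Sum>p=2..N. 2 * ln (real p) / real p ^ 2)"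
    proof (rule sum_mono)
      fix p assume p: "p \<in> {2..N}"
      let ?q = "1 / real p"
      have q: "0 \<le> ?q" "?q < 1" using p by auto
      have "(\<Sum>k=2..N. ?q ^ k) \<le> 2 * ?q ^ 2"
      proof -
        have "(\<Sum>k=2..N. ?q ^ k) = (\<Sum>k<N - 1. ?q ^ (k + 2))"
        proof (rule sum.reindex_bij_witness[of _ "\<lambda>k. k + 2" "\<lambda>k. k - 2"], goal_cases)
          case (5 a)
          then have "a - 2 + 2 = a" by auto
          then show ?case by (simp only:)
        qed auto
        also have "\<dots> = ?q ^ 2 * (\<Sum>k<N - 1. ?q ^ k)"
          by (simp only: power_add sum_distrib_left mult.commute)
        finally have *: "(\<Sum>k=2..N. ?q ^ k) = ?q ^ 2 * (\<Sum>k<N - 1. ?q ^ k)" .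
        have "(\<Sum>k<N - 1. ?q ^ k) \<le> (\<Sum>k. ?q ^ k)"
          using q by (intro sum_le_suminf summable_geometric) auto
        also have "(\<Sum>k. ?q ^ k) = 1 / (1 - ?q)" using q by (intro suminf_geometric) auto
        also have "\<dots> \<le> 2" using p by (simp add: field_simps)
        finally have "?q ^ 2 * (\<Sum>k<N - 1. ?q ^ k) \<le> ?q ^ 2 * 2"
          by (rule mult_left_mono) simp
        with * show ?thesis by simp
      qed
      then have "ln (real p) * (\<Sum>k=2..N. ?q ^ k) \<le> ln (real p) * (2 * ?q ^ 2)"
        using p by (intro mult_left_mono) auto
      then show "(\<Sum>k=2..N. ln (real p) / real p ^ k) \<le> 2 * ln (real p) / real p ^ 2"
        by (simp add: sum_distrib_left power_one_over mult.commute)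
    qed
    also have "\<dots> \<le> ?C"
      using nn by (intro sum_le_suminf[OF summ]) auto
    finally show "(\<Sum>d\<in>?D. mangoldt d / real d) \<le> ?C" .
  qed
qed

section \<open>The Dickman function\<close>

text \<open>The predicate inside the definite description of \<open>dickman_rho\<close>, named so
  that existence and uniqueness can be stated separately.\<close>

definition is_dickman :: "(real \<Rightarrow> real) \<Rightarrow> bool" where
  "is_dickman \<rho> \<longleftrightarrow> continuous_on {0..} \<rho>
      \<and> (\<forall>u\<in>{0..1}. \<rho> u = 1)
      \<and> (\<forall>u>1. \<exists>D. (\<rho> has_real_derivative D) (at u) \<and> u * D + \<rho> (u - 1) = 0)
      \<and> (\<forall>u<0. \<rho> u = 0)"

lemma is_dickman_DERIV:
  assumes "is_dickman \<rho>" "u > 1"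
  shows "(\<rho> has_real_derivative - \<rho> (u - 1) / u) (at u)"
proof -
  obtain D where "(\<rho> has_real_derivative D) (at u)" "u * D + \<rho> (u - 1) = 0"
    using assms unfolding is_dickman_def by blast
  moreover from this(2) have "D = - \<rho> (u - 1) / u"
    using assms(2) by (simp add: field_simps)
  ultimately show ?thesis by simp
qed

section \<open>Existence and uniqueness of the Dickman function by the method of steps\<close>

text \<open>Iterates of \<open>\<rho>(u) = 1 - \<integral>\<^sub>1\<^sup>u \<rho>(t - 1) / t dt\<close>; the integral over the empty interval makes them equal
  to 1 for \<open>u \<le> 1\<close>, and the \<open>n\<close>-th one is already final on \<open>[0, n + 1]\<close>.\<close>
fun dickman_step :: "nat \<Rightarrow> real \<Rightarrow> real" where
  "dickman_step 0 u = 1"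
| "dickman_step (Suc n) u = 1 - integral {1..u} (\<lambda>t. dickman_step n (t - 1) / t)"

lemma dickman_step_Suc_eq:
  "dickman_step (Suc n) = (\<lambda>u. 1 - integral {1..u} (\<lambda>t. dickman_step n (t - 1) / t))"
  by (rule ext) simp

lemma dickman_step_le_1: "u \<le> 1 \<Longrightarrow> dickman_step n u = 1"
  by (cases n) (auto simp: integral_empty less_eq_real_def)

lemma dickman_step_Suc_DERIV:
  assumes cont: "continuous_on UNIV (dickman_step n)" and u: "u > 1"
  shows "(dickman_step (Suc n) has_real_derivative - dickman_step n (u - 1) / u) (at u)"
proof -
  have "continuous_on {1..u+1} (\<lambda>t. dickman_step n (t - 1) / t)"
    by (intro continuous_intros continuous_on_compose2[OF cont]) auto
  then have "((\<lambda>v. integral {1..v} (\<lambda>t. dickman_step n (t - 1) / t)) has_real_derivative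
      dickman_step n (u - 1) / u) (at u within {1..u+1})"
    using u by (intro integral_has_real_derivative) auto
  then have "((\<lambda>v. integral {1..v} (\<lambda>t. dickman_step n (t - 1) / t)) has_real_derivative
      dickman_step n (u - 1) / u) (at u)"
    using u by (simp add: at_within_Icc_at)
  then have "((\<lambda>v. 1 - integral {1..v} (\<lambda>t. dickman_step n (t - 1) / t)) has_real_derivative
      0 - dickman_step n (u - 1) / u) (at u)"
    by (intro DERIV_diff DERIV_const)
  then show ?thesis by (simp add: dickman_step_Suc_eq)
qed

lemma continuous_dickman_step: "continuous_on UNIV (dickman_step n)"
proof (induction n)
  case 0
  have "dickman_step 0 = (\<lambda>_. 1)" by auto
  then show ?case by simp
next
  case (Suc n)
  have "isCont (dickman_step (Suc n)) u" for u
  proof -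
    consider "u < 1" | "u = 1" | "u > 1" by linarith
    then show ?thesis
    proof cases
      case 1
      have "\<forall>\<^sub>F v in nhds u. v < 1" using 1 eventually_nhds_in_open[of "{..<1}" u] by simp
      then have "\<forall>\<^sub>F v in nhds u. dickman_step (Suc n) v = 1"
        by eventually_elim (rule dickman_step_le_1, simp)
      from isCont_cong[OF this] show ?thesis by (simp del: dickman_step.simps)
    next
      \<comment> \<open>At the junction u = 1 the constant piece and the integral piece are each
        continuous on a closed interval ending there, and are glued.\<close>
      case 2
      have c: "continuous_on {1..2} (\<lambda>t. dickman_step n (t - 1) / t)"
        by (intro continuous_intros continuous_on_compose2[OF Suc]) auto
      have "continuous_on {1..2} (dickman_step (Suc n))"
        using indefinite_integral_continuous_1[OF integrable_continuous_real[OF c]]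
        by (auto intro!: continuous_intros)
      moreover have "continuous_on {0..1} (dickman_step (Suc n))"
        by (rule continuous_on_eq[OF continuous_on_const[of _ 1]]) (simp add: dickman_step_le_1 del: dickman_step.simps)
      ultimately have "continuous_on ({0..1} \<union> {1..2}) (dickman_step (Suc n))"
        by (intro continuous_on_closed_Un) auto
      moreover have "{0..1} \<union> {1..2} = {0..2::real}" by auto
      ultimately show ?thesis using 2 by (auto intro: continuous_on_interior)
    next
      case 3
      then show ?thesis using dickman_step_Suc_DERIV[OF Suc] DERIV_isCont by blast
    qed
  qed
  then show ?case by (simp add: continuous_at_imp_continuous_on del: dickman_step.simps)
qed

text \<open>An iterate at u sees the previous one only on [0, u - 1], so the range of agreement
  grows by one unit with each step.\<close>

lemma dickman_step_stable: "u \<le> real n + 1 \<Longrightarrow> dickman_step (Suc n) u = dickman_step n u"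
proof (induction n arbitrary: u)
  case 0
  then show ?case using dickman_step_le_1[of u 1] by simp
next
  case (Suc n)
  have "integral {1..u} (\<lambda>t. dickman_step (Suc n) (t - 1) / t)
      = integral {1..u} (\<lambda>t. dickman_step n (t - 1) / t)"
    using Suc.prems by (intro integral_cong) (auto simp: Suc.IH simp del: dickman_step.simps)
  then show ?case by (metis dickman_step.simps(2))
qed

lemma dickman_step_stable': "n \<le> m \<Longrightarrow> u \<le> real n + 1 \<Longrightarrow> dickman_step m u = dickman_step n u"
  by (induction rule: dec_induct) (auto simp: dickman_step_stable simp del: dickman_step.simps)

text \<open>The index \<open>nat \<lceil>u\<rceil>\<close> is merely large enough for the iterate to
  be final at u; by stability every larger index gives the same value.\<close>

definition dickman_sol :: "real \<Rightarrow> real" where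
  "dickman_sol u = (if u < 0 then 0 else dickman_step (nat \<lceil>u\<rceil>) u)"

lemma dickman_sol_eq: "0 \<le> u \<Longrightarrow> u \<le> real n + 1 \<Longrightarrow> dickman_sol u = dickman_step n u"
proof -
  assume u: "0 \<le> u" "u \<le> real n + 1"
  have "dickman_step (max n (nat \<lceil>u\<rceil>)) u = dickman_step n u"
    using u by (intro dickman_step_stable') auto
  moreover have "dickman_step (max n (nat \<lceil>u\<rceil>)) u = dickman_step (nat \<lceil>u\<rceil>) u"
    by (rule dickman_step_stable') (auto, linarith)
  ultimately show ?thesis using u by (simp add: dickman_sol_def)
qed

lemma is_dickman_dickman_sol: "is_dickman dickman_sol"
proof -
  have ev: "\<forall>\<^sub>F v in nhds u. dickman_sol v = dickman_step n v" if "0 < u" "u < real n + 1" for u n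
  proof -
    have "\<forall>\<^sub>F v in nhds u. v \<in> {0<..<real n + 1}"
      using that by (intro eventually_nhds_in_open) auto
    then show ?thesis by eventually_elim (auto intro: dickman_sol_eq)
  qed
  have D: "(dickman_sol has_real_derivative - dickman_sol (u - 1) / u) (at u)" if "u > 1" for u
  proof -
    \<comment> \<open>With this n, \<open>dickman_step (Suc n)\<close> agrees with the solution in a
      whole neighbourhood of u, and \<open>dickman_step n\<close> agrees with it at u - 1, so the
      derivative of the iterate is the required one.\<close>
    define n where "n = nat \<lceil>u\<rceil>"
    have n: "u \<le> real n" unfolding n_def by linarith
    have "(dickman_step (Suc n) has_real_derivative - dickman_step n (u - 1) / u) (at u)"
      using continuous_dickman_step that by (rule dickman_step_Suc_DERIV)
    moreover have "dickman_step n (u - 1) = dickman_sol (u - 1)"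
      using n that by (intro dickman_sol_eq[symmetric]) auto
    moreover have "\<forall>\<^sub>F v in nhds u. dickman_sol v = dickman_step (Suc n) v"
      using n that by (intro ev) auto
    ultimately show ?thesis using DERIV_cong_ev by metis
  qed
  have "continuous_on {0..} dickman_sol"
  proof -
    have "continuous (at u within {0..}) dickman_sol" if "u \<ge> 0" for u
    proof (cases "u > 1")
      case True
      then show ?thesis using D DERIV_isCont continuous_at_imp_continuous_at_within by blast
    next
      case False
      have "continuous_on {0..2} dickman_sol"
        by (rule continuous_on_eq[OF continuous_on_subset[OF continuous_dickman_step[of 1]]])
          (auto intro!: dickman_sol_eq[symmetric] simp del: dickman_step.simps)
      then have "continuous (at u within {0..2}) dickman_sol"
        using False that by (auto simp: continuous_on_eq_continuous_within)
      moreover have "at u within {0..2} = at u within {0..}"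
        using False by (intro at_within_nhd[of _ "{..<2}"]) auto
      ultimately show ?thesis by simp
    qed
    then show ?thesis by (simp add: continuous_on_eq_continuous_within)
  qed
  moreover have "\<forall>u\<in>{0..1}. dickman_sol u = 1"
    using dickman_sol_eq[of _ 0] by simp
  moreover have "\<exists>D. (dickman_sol has_real_derivative D) (at u) \<and> u * D + dickman_sol (u - 1) = 0"
    if "u > 1" for u
    using D[OF that] that by (intro exI[of _ "- dickman_sol (u - 1) / u"]) auto
  moreover have "\<forall>u<0. dickman_sol u = 0" by (simp add: dickman_sol_def)
  ultimately show ?thesis unfolding is_dickman_def by blast
qed

text \<open>If two solutions agree on [0, n + 1], the equation gives them equal derivatives between
  1 and n + 2, so their difference is constant there and equal to its value 0 at 1.\<close>

lemma is_dickman_unique: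
  assumes a: "is_dickman \<rho>" and b: "is_dickman \<rho>'"
  shows "\<rho> = \<rho>'"
proof -
  have *: "\<forall>u. 0 \<le> u \<and> u \<le> real n + 1 \<longrightarrow> \<rho> u = \<rho>' u" for n
  proof (induction n)
    case 0
    then show ?case using a b unfolding is_dickman_def by auto
  next
    case (Suc n)
    show ?case
    proof (intro allI impI)
      fix u assume u: "0 \<le> u \<and> u \<le> real (Suc n) + 1"
      show "\<rho> u = \<rho>' u"
      proof (cases "u \<le> 1")
        case True
        then show ?thesis using u a b unfolding is_dickman_def by auto
      next
        case False
        have "continuous_on {1..u} (\<lambda>v. \<rho> v - \<rho>' v)"
          using a b unfolding is_dickman_def
          by (intro continuous_on_diff) (auto elim: continuous_on_subset)
        moreover have "((\<lambda>v. \<rho> v - \<rho>' v) has_real_derivative 0) (at v)" if "1 < v" "v < u" for v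
        proof -
          have "\<rho> (v - 1) = \<rho>' (v - 1)" using Suc that u by auto
          then show ?thesis
            using DERIV_diff[OF is_dickman_DERIV[OF a, of v] is_dickman_DERIV[OF b, of v]] that by simp
        qed
        ultimately have "\<rho> u - \<rho>' u = \<rho> 1 - \<rho>' 1"
          using False by (intro DERIV_isconst_end) auto
        then show ?thesis using a b unfolding is_dickman_def by auto
      qed
    qed
  qed
  show ?thesis
  proof
    fix u
    show "\<rho> u = \<rho>' u"
    proof (cases "u < 0")
      case False
      have "u \<le> real (nat \<lceil>u\<rceil>) + 1" by linarith
      then show ?thesis using *[of "nat \<lceil>u\<rceil>"] False by auto
    qed (use a b in \<open>auto simp: is_dickman_def\<close>)
  qed
qed

lemma is_dickman_dickman_rho: "is_dickman dickman_rho"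
proof -
  have "dickman_rho = (THE \<rho>. is_dickman \<rho>)"
    unfolding dickman_rho_def is_dickman_def by simp
  then show ?thesis
    using theI[of is_dickman, OF is_dickman_dickman_sol] is_dickman_unique is_dickman_dickman_sol
    by metis
qed

section \<open>Sign, monotonicity and bounds of the Dickman function\<close>

lemma continuous_dickman_rho: "continuous_on {0..} dickman_rho"
  and dickman_rho_eq_1: "0 \<le> u \<Longrightarrow> u \<le> 1 \<Longrightarrow> dickman_rho u = 1"
  using is_dickman_dickman_rho unfolding is_dickman_def by auto

lemmas dickman_rho_DERIV = is_dickman_DERIV[OF is_dickman_dickman_rho]

text \<open>The differential equation says that v \<open>\<rho>\<close>(v) has derivative
  \<open>\<rho>\<close>(v) - \<open>\<rho>\<close>(v - 1), which is also the rate of change of the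
  integral over [v - 1, v]. Both sides equal 1 at v = 1.\<close>

lemma dickman_rho_integral:
  assumes "u \<ge> 1"
  shows "u * dickman_rho u = integral {u-1..u} dickman_rho"
proof -
  let ?r = dickman_rho
  have int: "?r integrable_on {a..b}" if "0 \<le> a" for a b
    using that by (intro integrable_continuous_real continuous_on_subset[OF continuous_dickman_rho]) auto
  have D: "((\<lambda>v. v * ?r v) has_real_derivative ?r v - ?r (v - 1)) (at v)" if "v > 1" for v
    using that by (auto intro!: derivative_eq_intros dickman_rho_DERIV)
  have "((\<lambda>v. ?r v - ?r (v - 1)) has_integral u * ?r u - 1 * ?r 1) {1..u}"
  \<comment> \<open>The interior form is used because the equation provides a derivative only for v
    > 1, not at the endpoint 1.\<close>
  proof (rule fundamental_theorem_of_calculus_interior)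
    show "continuous_on {1..u} (\<lambda>v. v * ?r v)"
      by (intro continuous_intros continuous_on_subset[OF continuous_dickman_rho]) auto
  qed (use assms D in \<open>auto simp: has_real_derivative_iff_has_vector_derivative\<close>)
  moreover have "((\<lambda>v. ?r v - ?r (v - 1)) has_integral
      integral {1..u} ?r - integral {0..u-1} ?r) {1..u}"
  proof (rule has_integral_diff)
    show "(?r has_integral integral {1..u} ?r) {1..u}" using int[of 1] by (simp add: integrable_integral)
    have "(?r has_integral integral {0..u-1} ?r) {0..u-1}" using int[of 0] by (simp add: integrable_integral)
    from has_integral_affinity[OF this[unfolded interval_cbox], of 1 "-1"]
    show "((\<lambda>v. ?r (v - 1)) has_integral integral {0..u-1} ?r) {1..u}" using assms
      by (simp add: add.commute)
  qed
  ultimately have "u * ?r u - 1 = integral {1..u} ?r - integral {0..u-1} ?r"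
    using dickman_rho_eq_1[of 1] has_integral_unique[of "\<lambda>v. ?r v - ?r (v - 1)"] by force
  moreover have "integral {0..1} ?r = 1"
    using integral_cong[of "{0..1}" ?r "\<lambda>_. 1"] dickman_rho_eq_1 by simp
  moreover have "integral {0..u} ?r = integral {0..1} ?r + integral {1..u} ?r"
    using assms int[of 0] by (intro Henstock_Kurzweil_Integration.integral_combine[symmetric]) auto
  moreover have "integral {0..u} ?r = integral {0..u-1} ?r + integral {u-1..u} ?r"
    using assms int[of 0] by (intro Henstock_Kurzweil_Integration.integral_combine[symmetric]) auto
  ultimately show ?thesis by linarith
qed

text \<open>The two properties feed each other: nonnegativity one unit earlier makes the derivative
  nonpositive, and monotonicity bounds \<open>\<rho>\<close>(u) by its integral over [u - 1, u],
  that is \<open>\<rho>\<close>(u) <= u \<open>\<rho>\<close>(u), which for u > 1 forces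
  \<open>\<rho>\<close>(u) >= 0.\<close>

lemma dickman_rho_antimono_nonneg_aux:
  "(\<forall>u. 0 \<le> u \<and> u \<le> real n + 1 \<longrightarrow> 0 \<le> dickman_rho u) \<and>
   (\<forall>u v. 0 \<le> u \<and> u \<le> v \<and> v \<le> real n + 1 \<longrightarrow> dickman_rho v \<le> dickman_rho u)"
proof (induction n)
  case 0
  then show ?case by (auto simp: dickman_rho_eq_1)
next
  case (Suc n)
  have mono: "dickman_rho v \<le> dickman_rho u" if "0 \<le> u" "u \<le> v" "v \<le> real (Suc n) + 1" for u v
  proof -
    have 1: "dickman_rho v \<le> dickman_rho u" if "1 \<le> u" "u \<le> v" "v \<le> real (Suc n) + 1" for u v
    proof (rule DERIV_nonpos_imp_decreasing_open[OF \<open>u \<le> v\<close>])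
      fix w assume w: "u < w" "w < v"
      then have "dickman_rho (w - 1) \<ge> 0" using Suc that by auto
      then show "\<exists>y. (dickman_rho has_real_derivative y) (at w) \<and> y \<le> 0"
        using dickman_rho_DERIV[of w] w that by (intro exI[of _ "- dickman_rho (w - 1) / w"]) auto
    qed (use that in \<open>auto intro!: continuous_on_subset[OF continuous_dickman_rho]\<close>)
    consider "v \<le> 1" | "u \<le> 1" "v \<ge> 1" | "u \<ge> 1" by linarith
    then show ?thesis
    proof cases
      case 2
      then show ?thesis using 1[of 1 v] that by (simp add: dickman_rho_eq_1)
    qed (use that 1 in \<open>auto simp: dickman_rho_eq_1\<close>)
  qed
  have "0 \<le> dickman_rho u" if "0 \<le> u" "u \<le> real (Suc n) + 1" for u
  proof (cases "u \<le> 1")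
    case False
    have "integral {u-1..u} (\<lambda>_. dickman_rho u) \<le> integral {u-1..u} dickman_rho"
      using False mono that
      by (intro integral_le integrable_continuous_real continuous_on_const
          continuous_on_subset[OF continuous_dickman_rho]) auto
    then have "dickman_rho u \<le> u * dickman_rho u"
      using dickman_rho_integral[of u] False by simp
    then have "0 \<le> (u - 1) * dickman_rho u" by (simp add: algebra_simps)
    then show ?thesis using False by (simp add: zero_le_mult_iff)
  qed (use that dickman_rho_eq_1 in auto)
  with mono show ?case by blast
qed

lemma dickman_rho_nonneg: "0 \<le> dickman_rho u"
proof (cases "u < 0")
  case True
  then show ?thesis using is_dickman_dickman_rho by (simp add: is_dickman_def)
next
  case False
  have "u \<le> real (nat \<lceil>u\<rceil>) + 1" by linarith
  then show ?thesis using dickman_rho_antimono_nonneg_aux[of "nat \<lceil>u\<rceil>"] False by auto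
qed

lemma dickman_rho_le_1: "dickman_rho u \<le> 1"
proof (cases "u < 0")
  case True
  then show ?thesis using is_dickman_dickman_rho by (simp add: is_dickman_def)
next
  case False
  have "u \<le> real (nat \<lceil>u\<rceil>) + 1" by linarith
  then have "dickman_rho u \<le> dickman_rho 0"
    using dickman_rho_antimono_nonneg_aux[of "nat \<lceil>u\<rceil>"] False by auto
  then show ?thesis using dickman_rho_eq_1[of 0] by simp
qed

section \<open>The function \<open>\<Pi>\<close>\<close>

definition is_Pi :: "(real \<Rightarrow> real) \<Rightarrow> bool" where
  "is_Pi P \<longleftrightarrow> (\<forall>u\<ge>0. 0 \<le> P u \<and> P u \<le> 1)
      \<and> P 0 = 1
      \<and> (\<forall>u\<in>{0<..1}. P u = 1)
      \<and> (\<forall>u>1. (\<lambda>t. P t * dickman_rho (u - t)) integrable_on {0..u}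
              \<and> P u = (1 / u) * integral {0..u} (\<lambda>t. P t * dickman_rho (u - t)))
      \<and> (\<forall>u<0. P u = 0)"

lemma is_Pi_eq_1: "is_Pi P \<Longrightarrow> 0 \<le> u \<Longrightarrow> u \<le> 1 \<Longrightarrow> P u = 1"
  unfolding is_Pi_def by (cases "u = 0") auto

section \<open>Contraction property of the integral equation and uniqueness of
  \<open>\<Pi>\<close>\<close>

text \<open>Vanishing on [0,1] shortens the effective interval from length u to u - 1. After
  division by u this saving is the contraction factor 1 - 1/u.\<close>

lemma abs_integral_le_of_zero_on_unit:
  fixes h :: "real \<Rightarrow> real"
  assumes "h integrable_on {0..u}" "u \<ge> 1" "B \<ge> 0"
    and "\<And>t. 0 \<le> t \<Longrightarrow> t \<le> u \<Longrightarrow> \<bar>h t\<bar> \<le> B"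
    and "\<And>t. 0 \<le> t \<Longrightarrow> t \<le> 1 \<Longrightarrow> h t = 0"
  shows "\<bar>integral {0..u} h\<bar> \<le> B * (u - 1)"
proof -
  have "integral {0..u} h = integral {0..1} h + integral {1..u} h"
    using assms by (intro Henstock_Kurzweil_Integration.integral_combine[symmetric]) auto
  also have "integral {0..1} h = integral {0..1} (\<lambda>_::real. 0)"
    by (rule integral_cong) (use assms in auto)
  finally have "integral {0..u} h = integral (cbox 1 u) h" by simp
  moreover have "h integrable_on {1..u}"
    by (rule integrable_on_subinterval[OF assms(1)]) auto
  then have "norm (integral (cbox 1 u) h) \<le> B * measure lborel (cbox 1 u)"
    using assms by (intro integrable_bound) auto
  ultimately show ?thesis using assms by simp
qed

text \<open>Two solutions agree on [0,1], so only the interval [1, u] contributes to the difference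
  of the integrals; the kernel \<open>\<rho>\<close> lies in [0,1] and does not increase it.\<close>

lemma is_Pi_contraction:
  assumes P: "is_Pi P" and Q: "is_Pi Q" and U: "U \<ge> 1" and B: "B \<ge> 0"
    and le: "\<And>t. 0 \<le> t \<Longrightarrow> t \<le> U \<Longrightarrow> \<bar>P t - Q t\<bar> \<le> B"
    and u: "0 \<le> u" "u \<le> U"
  shows "\<bar>P u - Q u\<bar> \<le> B * (1 - 1 / U)"
proof (cases "u \<le> 1")
  case True
  then show ?thesis using is_Pi_eq_1[OF P] is_Pi_eq_1[OF Q] u U B by simp
next
  case False
  have iP: "(\<lambda>t. P t * dickman_rho (u - t)) integrable_on {0..u}"
    and iQ: "(\<lambda>t. Q t * dickman_rho (u - t)) integrable_on {0..u}"
    and eP: "P u = (1 / u) * integral {0..u} (\<lambda>t. P t * dickman_rho (u - t))"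
    and eQ: "Q u = (1 / u) * integral {0..u} (\<lambda>t. Q t * dickman_rho (u - t))"
    using P Q False unfolding is_Pi_def by auto
  have "P u - Q u = (1 / u) * integral {0..u} (\<lambda>t. P t * dickman_rho (u - t) - Q t * dickman_rho (u - t))"
    using integral_diff[OF iP iQ] eP eQ by (simp add: right_diff_distrib)
  moreover have "\<bar>integral {0..u} (\<lambda>t. P t * dickman_rho (u - t) - Q t * dickman_rho (u - t))\<bar> \<le> B * (u - 1)"
  proof (rule abs_integral_le_of_zero_on_unit[OF integrable_diff[OF iP iQ] _ B])
    fix t assume t: "0 \<le> t" "t \<le> u"
    have "\<bar>P t - Q t\<bar> * dickman_rho (u - t) \<le> B * 1"
      using le[of t] t u dickman_rho_nonneg dickman_rho_le_1 B by (intro mult_mono) auto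
    then show "\<bar>P t * dickman_rho (u - t) - Q t * dickman_rho (u - t)\<bar> \<le> B"
      by (simp add: left_diff_distrib[symmetric] abs_mult dickman_rho_nonneg)
  qed (use False is_Pi_eq_1[OF P] is_Pi_eq_1[OF Q] in auto)
  ultimately have "\<bar>P u - Q u\<bar> \<le> (1 / u) * (B * (u - 1))"
    using False by (simp add: abs_mult divide_right_mono)
  also have "\<dots> = B * (1 - 1 / u)" using False by (simp add: field_simps)
  also have "\<dots> \<le> B * (1 - 1 / U)"
    using False u B by (intro mult_left_mono) (auto simp: field_simps)
  finally show ?thesis .
qed

text \<open>Both functions lie in [0,1], so their difference starts with the bound 1, and repeated
  contraction on [0, U] drives it to 0.\<close>

lemma is_Pi_unique:
  assumes P: "is_Pi P" and Q: "is_Pi Q"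
  shows "P = Q"
proof
  fix u
  show "P u = Q u"
  proof (cases "u < 0")
    case True
    then show ?thesis using P Q unfolding is_Pi_def by simp
  next
    case False
    define U where "U = max u 1"
    have U: "U \<ge> 1" "u \<le> U" unfolding U_def by auto
    have *: "\<forall>t. 0 \<le> t \<and> t \<le> U \<longrightarrow> \<bar>P t - Q t\<bar> \<le> (1 - 1 / U) ^ n" for n
    proof (induction n)
      case 0
      show ?case
      proof (intro allI impI)
        fix t assume "0 \<le> t \<and> t \<le> U"
        then have "0 \<le> P t \<and> P t \<le> 1" "0 \<le> Q t \<and> Q t \<le> 1"
          using P Q unfolding is_Pi_def by auto
        then show "\<bar>P t - Q t\<bar> \<le> (1 - 1 / U) ^ 0" by auto
      qed
    next
      case (Suc n)
      then show ?case
        using is_Pi_contraction[OF P Q U(1), of "(1 - 1 / U) ^ n"] U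
        by (simp add: mult.commute)
    qed
    have "(\<lambda>n. (1 - 1 / U) ^ n) \<longlonglongrightarrow> 0"
      using U by (intro LIMSEQ_power_zero) auto
    then have "\<bar>P u - Q u\<bar> \<le> 0"
      by (rule LIMSEQ_le_const) (use * False U in auto)
    then show ?thesis by simp
  qed
qed

section \<open>Existence and continuity of \<open>\<Pi>\<close> by successive approximation\<close>

text \<open>The substitution \<open>t = u s\<close> turns the operator of the integral equation into one that also covers
  \<open>u \<in> [0,1]\<close>, where it returns 1, so that all iterates are continuous on \<open>[0,\<infinity>)\<close>.\<close>
fun pi_iter :: "nat \<Rightarrow> real \<Rightarrow> real" where
  "pi_iter 0 u = 1"
| "pi_iter (Suc n) u = integral {0..1} (\<lambda>s. pi_iter n (u * s) * dickman_rho (u * (1 - s)))"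

lemma pi_iter_Suc_eq:
  "pi_iter (Suc n) = (\<lambda>u. integral {0..1} (\<lambda>s. pi_iter n (u * s) * dickman_rho (u * (1 - s))))"
  by (rule ext) simp

lemma continuous_pi_iter: "continuous_on {0..} (pi_iter n)"
proof (induction n)
  case 0
  have "pi_iter 0 = (\<lambda>_. 1)" by auto
  then show ?case by simp
next
  case (Suc n)
  have "continuous_on ({0..} \<times> cbox 0 1)
      (\<lambda>(u, s). pi_iter n (u * s) * dickman_rho (u * (1 - s)))"
    unfolding case_prod_unfold
    by (intro continuous_intros continuous_on_compose2[OF Suc]
        continuous_on_compose2[OF continuous_dickman_rho]) auto
  from integral_continuous_on_param[OF this] show ?case
    by (simp add: pi_iter_Suc_eq)
qed

lemma pi_iter_eq_1: "0 \<le> u \<Longrightarrow> u \<le> 1 \<Longrightarrow> pi_iter n u = 1"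
proof (induction n arbitrary: u)
  case (Suc n)
  have "integral {0..1} (\<lambda>s. pi_iter n (u * s) * dickman_rho (u * (1 - s))) = integral {0..1} (\<lambda>_::real. 1::real)"
    by (rule integral_cong) (use Suc in \<open>auto simp: mult_le_one dickman_rho_eq_1\<close>)
  then show ?case by simp
qed auto

lemma pi_iter_integrand_continuous:
  "continuous_on {0..u} (\<lambda>t. pi_iter n t * dickman_rho (u - t))"
  by (intro continuous_intros continuous_on_subset[OF continuous_pi_iter]
      continuous_on_compose2[OF continuous_dickman_rho]) auto

lemma pi_iter_Suc_integral:
  assumes "u > 0"
  shows "pi_iter (Suc n) u = (1 / u) * integral {0..u} (\<lambda>t. pi_iter n t * dickman_rho (u - t))"
proof -
  let ?f = "\<lambda>t. pi_iter n t * dickman_rho (u - t)"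
  have "(?f has_integral integral {0..u} ?f) (cbox 0 u)"
    using pi_iter_integrand_continuous by (simp add: integrable_continuous_real integrable_integral)
  from has_integral_affinity[OF this, of u 0]
  have "((\<lambda>s. pi_iter n (u * s) * dickman_rho (u * (1 - s))) has_integral (1 / u) * integral {0..u} ?f) {0..1}"
    using assms by (simp add: right_diff_distrib)
  then show ?thesis by (simp add: integral_unique)
qed

lemma pi_iter_bounds: "0 \<le> u \<Longrightarrow> 0 \<le> pi_iter n u \<and> pi_iter n u \<le> 1"
proof (induction n arbitrary: u)
  case (Suc n)
  have "continuous_on {0..1} (\<lambda>s. pi_iter n (u * s) * dickman_rho (u * (1 - s)))"
    using Suc.prems by (intro continuous_intros continuous_on_compose2[OF continuous_pi_iter]
      continuous_on_compose2[OF continuous_dickman_rho]) auto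
  then have int: "(\<lambda>s. pi_iter n (u * s) * dickman_rho (u * (1 - s))) integrable_on {0..1}"
    by (rule integrable_continuous_real)
  have pos: "0 \<le> pi_iter n (u * s) * dickman_rho (u * (1 - s))"
    and le: "pi_iter n (u * s) * dickman_rho (u * (1 - s)) \<le> 1" if "s \<in> {0..1}" for s
  proof -
    have "0 \<le> u * s" using that Suc.prems by simp
    from Suc.IH[OF this] show "0 \<le> pi_iter n (u * s) * dickman_rho (u * (1 - s))"
      "pi_iter n (u * s) * dickman_rho (u * (1 - s)) \<le> 1"
      by (simp_all add: mult_le_one dickman_rho_nonneg dickman_rho_le_1)
  qed
  have "integral {0..1} (\<lambda>s. pi_iter n (u * s) * dickman_rho (u * (1 - s))) \<le> integral {0..1} (\<lambda>_::real. 1)"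
    using int integrable_const_ivl le by (rule integral_le)
  moreover have "0 \<le> integral {0..1} (\<lambda>s. pi_iter n (u * s) * dickman_rho (u * (1 - s)))"
    using int pos by (rule Henstock_Kurzweil_Integration.integral_nonneg)
  ultimately show ?case by simp
qed auto

text \<open>The contraction argument again, now for consecutive iterates: all of them equal 1 on
  [0,1], and the first difference is at most 1 because the iterates lie in [0,1].\<close>

lemma pi_iter_diff:
  assumes U: "U \<ge> 1" and u: "0 \<le> u" "u \<le> U"
  shows "\<bar>pi_iter (Suc n) u - pi_iter n u\<bar> \<le> (1 - 1 / U) ^ n"
  using u
proof (induction n arbitrary: u)
  case 0
  then show ?case using pi_iter_bounds[of u 1] by simp
next
  case (Suc n)
  show ?case
  proof (cases "u \<le> 1")
    case True
    then show ?thesis using Suc U by (simp add: pi_iter_eq_1 del: pi_iter.simps)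
  next
    case False
    let ?f = "\<lambda>n t. pi_iter n t * dickman_rho (u - t)"
    let ?B = "(1 - 1 / U) ^ n"
    have B: "?B \<ge> 0" using U by simp
    have int: "?f n integrable_on {0..u}" for n
      by (intro integrable_continuous_real pi_iter_integrand_continuous)
    have "pi_iter (Suc (Suc n)) u - pi_iter (Suc n) u = (1 / u) * integral {0..u} (\<lambda>t. ?f (Suc n) t - ?f n t)"
      unfolding integral_diff[OF int int] right_diff_distrib
      using False by (simp add: pi_iter_Suc_integral del: pi_iter.simps)
    moreover have "\<bar>integral {0..u} (\<lambda>t. ?f (Suc n) t - ?f n t)\<bar> \<le> ?B * (u - 1)"
    proof (rule abs_integral_le_of_zero_on_unit[OF integrable_diff[OF int int] _ B])
      fix t assume t: "0 \<le> t" "t \<le> u"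
      have "\<bar>pi_iter (Suc n) t - pi_iter n t\<bar> * dickman_rho (u - t) \<le> ?B * 1"
        using Suc.IH[of t] t Suc.prems dickman_rho_nonneg dickman_rho_le_1 B by (intro mult_mono) auto
      then show "\<bar>?f (Suc n) t - ?f n t\<bar> \<le> ?B"
        by (simp add: left_diff_distrib[symmetric] abs_mult dickman_rho_nonneg del: pi_iter.simps)
    qed (use False in \<open>auto simp: pi_iter_eq_1 simp del: pi_iter.simps\<close>)
    ultimately have "\<bar>pi_iter (Suc (Suc n)) u - pi_iter (Suc n) u\<bar> \<le> (1 / u) * (?B * (u - 1))"
      using False by (simp add: abs_mult divide_right_mono del: pi_iter.simps)
    also have "\<dots> = ?B * (1 - 1 / u)" using False by (simp add: field_simps)
    also have "\<dots> \<le> ?B * (1 - 1 / U)"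
      using False Suc.prems B by (intro mult_left_mono) (auto simp: field_simps)
    finally show ?thesis by (simp add: mult.commute del: pi_iter.simps)
  qed
qed

text \<open>The series telescopes, so for u >= 0 this is the limit of \<open>pi_iter n u\<close>;
  the series form suits the Weierstrass test with the geometric majorant above.\<close>

definition pi_sol :: "real \<Rightarrow> real" where
  "pi_sol u = (if u < 0 then 0 else 1 + (\<Sum>n. pi_iter (Suc n) u - pi_iter n u))"

lemma uniform_limit_pi_iter: "uniform_limit {0..U} pi_iter pi_sol sequentially"
proof -
  define V where "V = max U 1"
  have V: "V \<ge> 1" "U \<le> V" unfolding V_def by auto
  have "uniform_limit {0..U} (\<lambda>n u. \<Sum>i<n. pi_iter (Suc i) u - pi_iter i u)
      (\<lambda>u. \<Sum>i. pi_iter (Suc i) u - pi_iter i u) sequentially"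
  proof (rule Weierstrass_m_test)
    fix n u assume "u \<in> {0..U}"
    then show "norm (pi_iter (Suc n) u - pi_iter n u) \<le> (1 - 1 / V) ^ n"
      using pi_iter_diff[OF V(1), of u n] V by (simp del: pi_iter.simps)
  next
    show "summable (\<lambda>n. (1 - 1 / V) ^ n)" using V by (intro summable_geometric) auto
  qed
  then have "uniform_limit {0..U} (\<lambda>n u. 1 + (\<Sum>i<n. pi_iter (Suc i) u - pi_iter i u))
      (\<lambda>u. 1 + (\<Sum>i. pi_iter (Suc i) u - pi_iter i u)) sequentially"
    by (intro uniform_limit_intros)
  moreover have "1 + (\<Sum>i<n. pi_iter (Suc i) u - pi_iter i u) = pi_iter n u" for n u
    using sum_lessThan_telescope[of "\<lambda>i. pi_iter i u" n] by (simp del: pi_iter.simps(2))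
  moreover have "1 + (\<Sum>i. pi_iter (Suc i) u - pi_iter i u) = pi_sol u" if "u \<in> {0..U}" for u
    using that by (simp add: pi_sol_def del: pi_iter.simps)
  ultimately show ?thesis
    using uniform_limit_cong'[of "{0..U}" "\<lambda>n u. 1 + (\<Sum>i<n. pi_iter (Suc i) u - pi_iter i u)" pi_iter
        "\<lambda>u. 1 + (\<Sum>i. pi_iter (Suc i) u - pi_iter i u)" pi_sol] by auto
qed

lemma tendsto_pi_iter: "0 \<le> u \<Longrightarrow> (\<lambda>n. pi_iter n u) \<longlonglongrightarrow> pi_sol u"
  by (rule tendsto_uniform_limitI[OF uniform_limit_pi_iter[of u]]) auto

lemma continuous_pi_sol: "continuous_on {0..} pi_sol"
proof -
  have "continuous (at u within {0..}) pi_sol" if "u \<ge> 0" for u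
  proof -
    have "continuous_on {0..u+1} pi_sol"
      by (rule uniform_limit_theorem[OF _ uniform_limit_pi_iter])
        (auto intro!: always_eventually continuous_on_subset[OF continuous_pi_iter])
    then have "continuous (at u within {0..u+1}) pi_sol"
      using that by (auto simp: continuous_on_eq_continuous_within)
    moreover have "at u within {0..u+1} = at u within {0..}"
      by (intro at_within_nhd[of _ "{..<u+1}"]) auto
    ultimately show ?thesis by simp
  qed
  then show ?thesis by (simp add: continuous_on_eq_continuous_within)
qed

text \<open>Bounds and the value 1 pass to pointwise limits. For the integral equation,
  multiplication by \<open>\<rho>\<close> in [0,1] preserves uniform convergence on [0, u], so the
  limit can be taken under the integral.\<close>

lemma is_Pi_pi_sol: "is_Pi pi_sol"
proof -
  have bounds: "0 \<le> pi_sol u \<and> pi_sol u \<le> 1" if "u \<ge> 0" for u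
    using LIMSEQ_le_const[OF tendsto_pi_iter[OF that], of 0]
      LIMSEQ_le_const2[OF tendsto_pi_iter[OF that], of 1] pi_iter_bounds[OF that] by auto
  have one: "pi_sol u = 1" if "0 \<le> u" "u \<le> 1" for u
    using LIMSEQ_unique[OF tendsto_pi_iter[OF that(1)], of 1] pi_iter_eq_1[OF that] by auto
  have fixpoint: "(\<lambda>t. pi_sol t * dickman_rho (u - t)) integrable_on {0..u}
      \<and> pi_sol u = (1 / u) * integral {0..u} (\<lambda>t. pi_sol t * dickman_rho (u - t))" if u: "u > 1" for u
  proof -
    have "uniform_limit {0..u} (\<lambda>n t. pi_iter n t * dickman_rho (u - t))
        (\<lambda>t. pi_sol t * dickman_rho (u - t)) sequentially"
    proof (rule uniform_limitI)
      fix e :: real assume "e > 0"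
      from uniform_limitD[OF uniform_limit_pi_iter this]
      show "\<forall>\<^sub>F n in sequentially. \<forall>t\<in>{0..u}.
          dist (pi_iter n t * dickman_rho (u - t)) (pi_sol t * dickman_rho (u - t)) < e"
      proof eventually_elim
        fix n assume elim: "\<forall>t\<in>{0..u}. dist (pi_iter n t) (pi_sol t) < e"
        have "dist (pi_iter n t * dickman_rho (u - t)) (pi_sol t * dickman_rho (u - t))
            \<le> dist (pi_iter n t) (pi_sol t)" for t
          using mult_left_mono[OF dickman_rho_le_1, of "\<bar>pi_iter n t - pi_sol t\<bar>" "u - t"]
          by (simp add: dist_real_def left_diff_distrib[symmetric] abs_mult dickman_rho_nonneg)
        then show "\<forall>t\<in>{0..u}.
          dist (pi_iter n t * dickman_rho (u - t)) (pi_sol t * dickman_rho (u - t)) < e"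
          using elim by (blast intro: le_less_trans)
      qed
    qed
    then obtain I J where I: "\<And>n. ((\<lambda>t. pi_iter n t * dickman_rho (u - t)) has_integral I n) {0..u}"
      and J: "((\<lambda>t. pi_sol t * dickman_rho (u - t)) has_integral J) {0..u}" and lim: "I \<longlonglongrightarrow> J"
      by (rule uniform_limit_integral[OF _ pi_iter_integrand_continuous]) auto
    have "(\<lambda>n. (1 / u) * I n) \<longlonglongrightarrow> (1 / u) * J" using lim by (intro tendsto_intros)
    moreover have "(1 / u) * I n = pi_iter (Suc n) u" for n
      using pi_iter_Suc_integral[of u n] I[of n] u by (simp add: integral_unique del: pi_iter.simps)
    ultimately have "(\<lambda>n. pi_iter (Suc n) u) \<longlonglongrightarrow> (1 / u) * J" by (simp del: pi_iter.simps)
    moreover have "(\<lambda>n. pi_iter (Suc n) u) \<longlonglongrightarrow> pi_sol u"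
      using tendsto_pi_iter[of u] u by (intro LIMSEQ_Suc) auto
    ultimately have "pi_sol u = (1 / u) * J" by (rule LIMSEQ_unique[rotated])
    with J show ?thesis by (auto simp: has_integral_integrable integral_unique)
  qed
  show ?thesis
    unfolding is_Pi_def
  proof (intro conjI)
    show "\<forall>u<0. pi_sol u = 0" by (simp add: pi_sol_def)
  qed (use bounds one fixpoint in auto)
qed

lemma Pi_fun_eq_pi_sol: "Pi_fun = pi_sol"
proof -
  have "Pi_fun = (THE P. is_Pi P)" unfolding Pi_fun_def is_Pi_def by simp
  then show ?thesis using is_Pi_pi_sol is_Pi_unique by (simp add: the_equality)
qed

lemma continuous_Pi_fun: "continuous_on {0..} Pi_fun"
  by (simp add: Pi_fun_eq_pi_sol continuous_pi_sol)

lemma is_Pi_Pi_fun: "is_Pi Pi_fun"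
  by (simp add: Pi_fun_eq_pi_sol is_Pi_pi_sol)

lemma Pi_fun_bounds: "0 \<le> u \<Longrightarrow> 0 \<le> Pi_fun u \<and> Pi_fun u \<le> 1"
  using is_Pi_Pi_fun unfolding is_Pi_def by simp

text \<open>On [0,1] the integrand is identically 1, so the equation extends down to u = 0. The
  reflection t -> u - t puts the integrand in the same shape as the sum over d, where
  \<open>\<rho>\<close> is evaluated at t(d).\<close>

lemma Pi_fun_integral:
  assumes "u \<ge> 0"
  shows "((\<lambda>t. dickman_rho t * Pi_fun (u - t)) has_integral u * Pi_fun u) {0..u}"
proof -
  let ?f = "\<lambda>t. Pi_fun t * dickman_rho (u - t)"
  have "(?f has_integral u * Pi_fun u) {0..u}"
  proof (cases "u \<le> 1")
    case True
    have "((\<lambda>_. 1::real) has_integral u) {0..u}"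
      using has_integral_const_real[of "1::real" 0 u] assms
      by (simp only: content_real real_scaleR_def mult_1_right diff_zero)
    moreover have "?f t = 1" if "t \<in> {0..u}" for t
      using that True by (auto simp: dickman_rho_eq_1 is_Pi_eq_1[OF is_Pi_Pi_fun])
    ultimately have "(?f has_integral u) {0..u}"
      using has_integral_cong[of "{0..u}" ?f "\<lambda>_. 1"] by blast
    then show ?thesis using is_Pi_eq_1[OF is_Pi_Pi_fun assms True] by simp
  next
    case False
    then have "?f integrable_on {0..u}" "Pi_fun u = (1 / u) * integral {0..u} ?f"
      using is_Pi_Pi_fun unfolding is_Pi_def by auto
    then show ?thesis using False integrable_integral[of ?f "{0..u}"] by simp
  qed
  then have "(?f has_integral u * Pi_fun u) (cbox 0 u)" by simp
  from has_integral_affinity[OF this, of "-1" u]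
  have "((\<lambda>t. Pi_fun (u - t) * dickman_rho t) has_integral u * Pi_fun u) ((\<lambda>t. u - t) ` {0..u})"
    by simp
  then show ?thesis by (simp add: mult.commute)
qed

section \<open>Comparing weighted sums with integrals\<close>

text \<open>Cut the range into K cells of length h. The mass hypothesis at its two ends shows that
  each cell carries mass h up to 2 \<open>\<epsilon>\<close>, so sum and integral can both be
  compared with the value of g at the right endpoint. The first \<open>\<epsilon>\<close> accounts
  for weights sitting at 0.\<close>

lemma weighted_sum_approx_integral:
  fixes w t :: "'a \<Rightarrow> real" and g :: "real \<Rightarrow> real"
  assumes fin: "finite D" and w: "\<And>d. d \<in> D \<Longrightarrow> w d \<ge> 0" and t: "\<And>d. d \<in> D \<Longrightarrow> t d \<ge> 0"
    and mass: "\<And>s. 0 \<le> s \<Longrightarrow> s \<le> real K * h \<Longrightarrow> \<bar>(\<Sum>d\<in>{d\<in>D. t d \<le> s}. w d) - s\<bar> \<le> \<epsilon>"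
    and cont: "continuous_on {0..real K * h} g"
    and bound: "\<And>s. 0 \<le> s \<Longrightarrow> s \<le> real K * h \<Longrightarrow> \<bar>g s\<bar> \<le> 1"
    and osc: "\<And>s r. 0 \<le> s \<Longrightarrow> s \<le> r \<Longrightarrow> r \<le> real K * h \<Longrightarrow> r - s \<le> h \<Longrightarrow> \<bar>g s - g r\<bar> \<le> \<omega>"
    and h: "h \<ge> 0" and \<omega>: "\<omega> \<ge> 0"
  shows "\<bar>(\<Sum>d\<in>{d\<in>D. t d \<le> real K * h}. w d * g (t d)) - integral {0..real K * h} g\<bar>
      \<le> \<epsilon> + real K * (2 * \<omega> * h + 2 * \<epsilon> * (1 + \<omega>))"
proof -
  let ?Q = "2 * \<omega> * h + 2 * \<epsilon> * (1 + \<omega>)"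
  have "\<bar>(\<Sum>d\<in>{d\<in>D. t d \<le> real k * h}. w d * g (t d)) - integral {0..real k * h} g\<bar>
      \<le> \<epsilon> + real k * ?Q" if "k \<le> K" for k
    using that
  proof (induction k)
    case 0
    have Kh: "0 \<le> real K * h" using h by simp
    have "\<bar>\<Sum>d\<in>{d\<in>D. t d \<le> 0}. w d * g (t d)\<bar> \<le> (\<Sum>d\<in>{d\<in>D. t d \<le> 0}. \<bar>w d * g (t d)\<bar>)"
      by (rule sum_abs)
    also have "\<dots> \<le> (\<Sum>d\<in>{d\<in>D. t d \<le> 0}. w d)"
    proof (rule sum_mono)
      fix d assume d: "d \<in> {d\<in>D. t d \<le> 0}"
      then have "t d = 0" using t[of d] by auto
      then show "\<bar>w d * g (t d)\<bar> \<le> w d"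
        using w[of d] bound[of 0] Kh d by (simp add: abs_mult mult_left_le)
    qed
    also have "\<dots> \<le> \<epsilon>" using mass[of 0] Kh by simp
    finally show ?case by simp
  next
    case (Suc k)
    define a where "a = real k * h"
    define b where "b = real (Suc k) * h"
    have "b \<le> real K * h" unfolding b_def using h Suc.prems by (intro mult_right_mono) auto
    then have ab: "0 \<le> a" "a \<le> b" "b \<le> real K * h" "b - a = h"
      using h by (auto simp: a_def b_def distrib_right)
    have split: "{d\<in>D. t d \<le> b} = {d\<in>D. t d \<le> a} \<union> {d\<in>D. a < t d \<and> t d \<le> b}"
      using ab by auto
    have sum_split: "(\<Sum>d\<in>{d\<in>D. t d \<le> b}. F d)
        = (\<Sum>d\<in>{d\<in>D. t d \<le> a}. F d) + (\<Sum>d\<in>{d\<in>D. a < t d \<and> t d \<le> b}. F d)" for F :: "'a \<Rightarrow> real"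
      unfolding split using fin by (intro sum.union_disjoint) auto
    let ?J = "{d\<in>D. a < t d \<and> t d \<le> b}"
    have J: "\<bar>(\<Sum>d\<in>?J. w d) - h\<bar> \<le> 2 * \<epsilon>"
      using mass[of a] mass[of b] ab sum_split[of w] by linarith
    have ig: "g integrable_on {0..b}"
      by (rule integrable_continuous_real[OF continuous_on_subset[OF cont]]) (use ab in auto)
    have ig': "g integrable_on {a..b}"
      by (rule integrable_on_subinterval[OF ig]) (use ab in auto)
    have "\<bar>integral {a..b} (\<lambda>s. g s - g b)\<bar> \<le> \<omega> * (b - a)"
    proof -
      have "norm (integral (cbox a b) (\<lambda>s. g s - g b)) \<le> \<omega> * measure lborel (cbox a b)"
      proof (rule integrable_bound[OF \<omega>])
        show "(\<lambda>s. g s - g b) integrable_on cbox a b"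
          using ig' by (auto intro!: integrable_diff)
        fix s assume "s \<in> cbox a b"
        then show "norm (g s - g b) \<le> \<omega>"
          using ab osc[of s b] by auto
      qed
      then show ?thesis using ab by simp
    qed
    moreover have "integral {a..b} (\<lambda>s. g s - g b) = integral {a..b} g - g b * h"
      using ab by (subst integral_diff[OF ig']) (auto simp: mult.commute)
    ultimately have 1: "\<bar>integral {a..b} g - g b * h\<bar> \<le> \<omega> * h" using ab by simp
    have "\<bar>\<Sum>d\<in>?J. w d * (g (t d) - g b)\<bar> \<le> (\<Sum>d\<in>?J. \<bar>w d * (g (t d) - g b)\<bar>)" by (rule sum_abs)
    also have "\<dots> \<le> (\<Sum>d\<in>?J. w d * \<omega>)"
    proof (rule sum_mono)
      fix d assume d: "d \<in> ?J"
      then show "\<bar>w d * (g (t d) - g b)\<bar> \<le> w d * \<omega>"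
        using w[of d] osc[of "t d" b] ab t[of d] by (auto simp: abs_mult intro!: mult_left_mono)
    qed
    also have "\<dots> = (\<Sum>d\<in>?J. w d) * \<omega>" by (simp add: sum_distrib_right)
    also have "\<dots> \<le> (h + 2 * \<epsilon>) * \<omega>" using J \<omega> by (intro mult_right_mono) auto
    finally have 2: "\<bar>(\<Sum>d\<in>?J. w d * g (t d)) - (\<Sum>d\<in>?J. w d) * g b\<bar> \<le> (h + 2 * \<epsilon>) * \<omega>"
      by (simp add: right_diff_distrib sum_subtractf sum_distrib_right)
    have 3: "\<bar>(\<Sum>d\<in>?J. w d) * g b - h * g b\<bar> \<le> 2 * \<epsilon>"
    proof -
      have "\<bar>((\<Sum>d\<in>?J. w d) - h) * g b\<bar> \<le> (2 * \<epsilon>) * 1"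
        unfolding abs_mult using J bound[of b] ab by (intro mult_mono) auto
      then show ?thesis by (simp add: left_diff_distrib)
    qed
    have int_split: "integral {0..b} g = integral {0..a} g + integral {a..b} g"
      using ab ig by (intro Henstock_Kurzweil_Integration.integral_combine[symmetric]) auto
    have IH: "\<bar>(\<Sum>d\<in>{d\<in>D. t d \<le> a}. w d * g (t d)) - integral {0..a} g\<bar> \<le> \<epsilon> + real k * ?Q"
      unfolding a_def using Suc by simp
    \<comment> \<open>The budget of one cell: variation of g under the sum, error in the mass,
      variation of g under the integral.\<close>
    have Q: "\<epsilon> + real (Suc k) * ?Q = (\<epsilon> + real k * ?Q) + (h + 2 * \<epsilon>) * \<omega> + 2 * \<epsilon> + \<omega> * h"
      by (simp add: algebra_simps)
    show ?case
      unfolding b_def[symmetric] sum_split int_split Q using IH 1 2 3 by (simp only: mult.commute[of h "g b"])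
  qed
  then show ?thesis by simp
qed

text \<open>Let M be the supremum of E on [1, U]. In the sum, E(v - t) is bounded by M where v - t
  >= 1, by q where it lies in [\<open>\<eta>\<close>, 1), and by 1 below \<open>\<eta>\<close>; the
  three masses are about v - 1, at most about v, and about \<open>\<eta>\<close>. Dividing by v
  gives M <= \<open>\<sigma>\<close> + (1 - 1/U) M, hence M <= U \<open>\<sigma>\<close>.\<close>

lemma renewal_inequality_bound:
  fixes w t :: "'a \<Rightarrow> real" and E :: "real \<Rightarrow> real"
  assumes fin: "finite D" and w: "\<And>d. d \<in> D \<Longrightarrow> w d \<ge> 0" and t: "\<And>d. d \<in> D \<Longrightarrow> t d \<ge> 0"
    and mass: "\<And>s. 0 \<le> s \<Longrightarrow> s \<le> U \<Longrightarrow> \<bar>(\<Sum>d\<in>{d\<in>D. t d \<le> s}. w d) - s\<bar> \<le> \<epsilon>"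
    and U: "U \<ge> 1" and \<eta>: "0 \<le> \<eta>" "\<eta> \<le> 1" and q: "q \<ge> 0"
    and E: "\<And>s. 0 \<le> s \<Longrightarrow> s \<le> U \<Longrightarrow> 0 \<le> E s \<and> E s \<le> 1"
    and small: "\<And>s. \<eta> \<le> s \<Longrightarrow> s \<le> 1 \<Longrightarrow> E s \<le> q"
    and ineq: "\<And>u. 1 \<le> u \<Longrightarrow> u \<le> U \<Longrightarrow>
      u * E u \<le> \<tau> + (\<Sum>d\<in>{d\<in>D. t d \<le> u}. w d * E (u - t d))"
    and u: "1 \<le> u" "u \<le> U"
  shows "E u \<le> U * (\<tau> + 3 * \<epsilon> + q * (U + \<epsilon>) + \<eta>)"
proof -
  define M where "M = (SUP s\<in>{1..U}. E s)"
  define \<sigma> where "\<sigma> = \<tau> + 3 * \<epsilon> + q * (U + \<epsilon>) + \<eta>"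
  have bdd: "bdd_above (E ` {1..U})" using E by (intro bdd_aboveI[of _ 1]) auto
  have EM: "E s \<le> M" if "1 \<le> s" "s \<le> U" for s
    unfolding M_def using that by (intro cSUP_upper bdd) auto
  have M0: "0 \<le> M" using EM[of 1] E[of 1] U by auto
  have M1: "M \<le> 1" unfolding M_def using U E by (intro cSUP_least) auto
  have \<epsilon>: "\<epsilon> \<ge> 0" using mass[of 0] U by linarith
  have step: "v * E v \<le> \<sigma> + M * (v - 1)" if v: "1 \<le> v" "v \<le> U" for v
  proof -
    let ?D = "\<lambda>s. {d\<in>D. t d \<le> s}"
    have indicator: "(\<Sum>d\<in>?D v. w d * (if t d \<le> s then 1 else 0)) = (\<Sum>d\<in>?D s. w d)" if "s \<le> v" for s
    proof -
      have "(\<Sum>d\<in>?D v. w d * (if t d \<le> s then 1 else 0)) = (\<Sum>d\<in>?D v. if t d \<le> s then w d else 0)"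
        by (rule sum.cong) auto
      also have "\<dots> = (\<Sum>d\<in>{d\<in>?D v. t d \<le> s}. w d)"
        using fin by (subst sum.inter_filter) auto
      also have "{d\<in>?D v. t d \<le> s} = ?D s" using that by auto
      finally show ?thesis .
    qed
    \<comment> \<open>The majorant is built from indicators of initial segments, so that only
      cumulative masses, which the hypothesis controls, remain.\<close>
    have "(\<Sum>d\<in>?D v. w d * E (v - t d)) \<le> (\<Sum>d\<in>?D v.
        M * (w d * (if t d \<le> v - 1 then 1 else 0)) + q * w d + (w d - w d * (if t d \<le> v - \<eta> then 1 else 0)))"
    proof (rule sum_mono)
      fix d assume d: "d \<in> ?D v"
      have s: "0 \<le> v - t d" "v - t d \<le> U" using d t[of d] v by auto
      have "E (v - t d) \<le> M * (if t d \<le> v - 1 then 1 else 0) + q + (1 - (if t d \<le> v - \<eta> then 1 else 0))"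
      proof -
        consider "t d \<le> v - 1" | "t d > v - 1" "t d \<le> v - \<eta>" | "t d > v - \<eta>" by linarith
        then show ?thesis
        proof cases
          case 1
          then show ?thesis using EM[of "v - t d"] s q by auto
        next
          case 2
          then show ?thesis using small[of "v - t d"] by auto
        next
          case 3
          then show ?thesis using E[OF s] q M0 \<eta> by auto
        qed
      qed
      then have "w d * E (v - t d)
          \<le> w d * (M * (if t d \<le> v - 1 then 1 else 0) + q + (1 - (if t d \<le> v - \<eta> then 1 else 0)))"
        using w[of d] d by (intro mult_left_mono) auto
      then show "w d * E (v - t d) \<le> M * (w d * (if t d \<le> v - 1 then 1 else 0)) + q * w d
          + (w d - w d * (if t d \<le> v - \<eta> then 1 else 0))"
        by (simp add: algebra_simps)
    qed
    also have "\<dots> = M * (\<Sum>d\<in>?D (v - 1). w d) + q * (\<Sum>d\<in>?D v. w d)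
        + ((\<Sum>d\<in>?D v. w d) - (\<Sum>d\<in>?D (v - \<eta>). w d))"
      unfolding sum.distrib sum_subtractf sum_distrib_left[symmetric]
      using \<eta> by (simp only: indicator)
    also have "\<dots> \<le> M * (v - 1 + \<epsilon>) + q * (v + \<epsilon>) + (\<eta> + 2 * \<epsilon>)"
    proof (intro add_mono mult_left_mono M0 q)
      show "(\<Sum>d\<in>?D (v - 1). w d) \<le> v - 1 + \<epsilon>" using mass[of "v - 1"] v by linarith
      show "(\<Sum>d\<in>?D v. w d) \<le> v + \<epsilon>" using mass[of v] v by linarith
      show "(\<Sum>d\<in>?D v. w d) - (\<Sum>d\<in>?D (v - \<eta>). w d) \<le> \<eta> + 2 * \<epsilon>"
        using mass[of v] mass[of "v - \<eta>"] v \<eta> by linarith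
    qed
    finally have "v * E v \<le> \<tau> + (M * (v - 1 + \<epsilon>) + q * (v + \<epsilon>) + (\<eta> + 2 * \<epsilon>))"
      using ineq[OF v] by linarith
    \<comment> \<open>Bounding M by 1 in this product turns it into the third
      \<open>\<epsilon>\<close> of \<open>\<sigma>\<close>; the other two come from the mass near
      v.\<close>
    moreover have "M * \<epsilon> \<le> 1 * \<epsilon>" by (intro mult_right_mono M1 \<epsilon>)
    moreover have "q * (v + \<epsilon>) \<le> q * (U + \<epsilon>)" using v q by (intro mult_left_mono) auto
    ultimately show ?thesis unfolding \<sigma>_def by (simp add: distrib_left)
  qed
  \<comment> \<open>At v = 1 the term with M disappears. The sign is used below in
    \<open>\<sigma> / v \<le> \<sigma>\<close>.\<close>
  have \<sigma>0: "\<sigma> \<ge> 0" using step[of 1] E[of 1] U by auto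
  have "E v \<le> \<sigma> + M * (1 - 1 / U)" if v: "1 \<le> v" "v \<le> U" for v
  proof -
    have "E v \<le> (\<sigma> + M * (v - 1)) / v" using step[OF v] v by (simp add: pos_le_divide_eq mult.commute)
    also have "\<dots> = \<sigma> / v + M * (1 - 1 / v)" using v by (simp add: field_simps)
    also have "\<dots> \<le> \<sigma> + M * (1 - 1 / U)"
    proof (intro add_mono mult_left_mono M0)
      show "\<sigma> / v \<le> \<sigma>" using v \<sigma>0 by (simp add: divide_le_eq mult_le_cancel_left1)
      show "1 - 1 / v \<le> 1 - 1 / U" using v by (simp add: frac_le)
    qed
    finally show ?thesis .
  qed
  then have "M \<le> \<sigma> + M * (1 - 1 / U)"
    using U by (subst (1) M_def, intro cSUP_least) auto
  then have "M \<le> U * \<sigma>" using U by (simp add: field_simps)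
  then show ?thesis using EM[OF u] unfolding \<sigma>_def by linarith
qed

section \<open>Mean values\<close>

text \<open>The double sum is exactly the sum of f(n) ln n. Replacing ln n by ln y adds the
  nonnegative quantity f(n) (ln y - ln n); since f <= 1, the total is at most N ln y - ln N!, which
  weak Stirling and ln(y/N) <= y/N - 1 bound by y.\<close>

lemma sum_completely_multiplicative_ln_approx:
  fixes f :: "nat \<Rightarrow> real"
  assumes mult: "\<And>m n. m > 0 \<Longrightarrow> n > 0 \<Longrightarrow> f (m * n) = f m * f n"
    and f: "\<And>n. 0 \<le> f n \<and> f n \<le> 1" and y: "y \<ge> 1"
  shows "\<bar>ln y * (\<Sum>n=1..nat \<lfloor>y\<rfloor>. f n)
    - (\<Sum>d=1..nat \<lfloor>y\<rfloor>. mangoldt d * f d * (\<Sum>n=1..nat \<lfloor>y / real d\<rfloor>. f n))\<bar> \<le> y"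
proof -
  define N where "N = nat \<lfloor>y\<rfloor>"
  have N: "N \<ge> 1" "real N \<le> y" using y unfolding N_def by (auto simp: le_nat_iff)
  \<comment> \<open>Nested floors: the real cutoff y/d and the integer cutoff N/d admit the same
    n.\<close>
  have "nat \<lfloor>y / real d\<rfloor> = N div d" for d
    using floor_divide_real_eq_div[of "int d" y] y by (simp add: N_def nat_div_distrib)
  then have "(\<Sum>d=1..N. mangoldt d * f d * (\<Sum>n=1..nat \<lfloor>y / real d\<rfloor>. f n)) = (\<Sum>n=1..N. f n * ln (real n))"
    using sum_completely_multiplicative_ln[of f N, OF mult] by simp
  then have eq: "ln y * (\<Sum>n=1..N. f n) - (\<Sum>d=1..N. mangoldt d * f d * (\<Sum>n=1..nat \<lfloor>y / real d\<rfloor>. f n))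
      = (\<Sum>n=1..N. f n * (ln y - ln (real n)))"
    by (simp add: sum_distrib_left right_diff_distrib sum_subtractf mult.commute)
  have le: "ln (real n) \<le> ln y" if "n \<in> {1..N}" for n using that N by auto
  have "0 \<le> (\<Sum>n=1..N. f n * (ln y - ln (real n)))"
    using f le by (intro sum_nonneg mult_nonneg_nonneg) auto
  moreover have "(\<Sum>n=1..N. f n * (ln y - ln (real n))) \<le> (\<Sum>n=1..N. 1 * (ln y - ln (real n)))"
    using f le by (intro sum_mono mult_right_mono) auto
  moreover have "(\<Sum>n=1..N. 1 * (ln y - ln (real n))) = real N * ln y - ln (fact N)"
    by (simp add: ln_fact_eq_sum sum_subtractf)
  moreover have "real N * ln y - ln (fact N) \<le> real N * ln y - real N * ln (real N) + real N"
    using ln_fact_ge[of N] by linarith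
  moreover have "real N * ln y - real N * ln (real N) \<le> y - real N"
  proof -
    have "ln y - ln (real N) = ln (y / real N)" using N y by (simp add: ln_div)
    also have "\<dots> \<le> y / real N - 1" using N y by (intro ln_le_minus_one) auto
    finally have "real N * (ln y - ln (real N)) \<le> real N * (y / real N - 1)"
      by (rule mult_left_mono) simp
    then show ?thesis using N by (simp add: right_diff_distrib)
  qed
  ultimately show ?thesis unfolding N_def[symmetric] eq by linarith
qed

section \<open>The function f_x, its mean values and their approximate renewal equation\<close>

text \<open>Over the multiset of prime factors, multiplicativity reduces to additivity of prime
  factorizations.\<close>

lemma f_mult_eq_prod_mset:
  "f_mult x n = (\<Prod>p\<in>#prime_factorization n. dickman_rho (ln (real p) / ln x))"
  unfolding f_mult_def image_prod_mset_multiplicity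
  by (rule prod.cong) (auto simp: count_prime_factorization_prime in_prime_factors_imp_prime)

lemma f_mult_mult: "m > 0 \<Longrightarrow> n > 0 \<Longrightarrow> f_mult x (m * n) = f_mult x m * f_mult x n"
  by (simp add: f_mult_eq_prod_mset prime_factorization_mult)

lemma f_mult_prime: "prime p \<Longrightarrow> f_mult x p = dickman_rho (ln (real p) / ln x)"
  by (simp add: f_mult_eq_prod_mset prime_factorization_prime)

lemma f_mult_bounds: "0 \<le> f_mult x n \<and> f_mult x n \<le> 1"
  unfolding f_mult_def
  by (auto intro!: prod_nonneg prod_le_1 power_le_one simp: dickman_rho_nonneg dickman_rho_le_1)

lemma f_mult_eq_1:
  assumes "x > 1" "n > 0" "real n \<le> x"
  shows "f_mult x n = 1"
  unfolding f_mult_def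
proof (rule prod.neutral, rule ballI)
  fix p assume p: "p \<in> prime_factors n"
  then have "p dvd n" "p \<ge> 2" by (auto simp: in_prime_factors_iff prime_ge_2_nat)
  then have "real p \<le> x" using assms dvd_imp_le[of p n] by linarith
  then have "dickman_rho (ln (real p) / ln x) = 1"
    using assms \<open>p \<ge> 2\<close> by (intro dickman_rho_eq_1) (auto simp: divide_simps)
  then show "dickman_rho (ln (real p) / ln x) ^ multiplicity p n = 1" by simp
qed

definition mean_f :: "real \<Rightarrow> real \<Rightarrow> real" where
  "mean_f x u = (1 / x powr u) * (\<Sum>n\<in>{1..nat \<lfloor>x powr u\<rfloor>}. f_mult x n)"

lemma mean_f_bounds: "0 \<le> mean_f x u \<and> mean_f x u \<le> 1"
proof
  show "0 \<le> mean_f x u"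
    unfolding mean_f_def using f_mult_bounds by (intro mult_nonneg_nonneg sum_nonneg) auto
  have "(\<Sum>n\<in>{1..nat \<lfloor>x powr u\<rfloor>}. f_mult x n) \<le> (\<Sum>n\<in>{1..nat \<lfloor>x powr u\<rfloor>}. 1)"
    using f_mult_bounds by (intro sum_mono) auto
  also have "\<dots> \<le> x powr u" by simp
  finally show "mean_f x u \<le> 1"
    unfolding mean_f_def by (cases "x powr u = 0") (auto simp: divide_le_eq_1)
qed

text \<open>For u <= 1 every n <= x^u satisfies f_x(n) = 1, so the sum merely counts integers and
  only rounding is lost. The bound deteriorates as u approaches 0, which is why a cutoff
  \<open>\<eta>\<close> appears later.\<close>

lemma mean_f_near_1:
  assumes "x > 1" "u \<le> 1"
  shows "\<bar>mean_f x u - 1\<bar> \<le> x powr (- u)"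
proof -
  have "x powr u \<le> x powr 1" using assms by (intro powr_mono) auto
  then have xu: "x powr u \<le> x" using assms by simp
  have "(\<Sum>n\<in>{1..nat \<lfloor>x powr u\<rfloor>}. f_mult x n) = (\<Sum>n\<in>{1..nat \<lfloor>x powr u\<rfloor>}. 1)"
  proof (rule sum.cong[OF refl])
    fix n assume n: "n \<in> {1..nat \<lfloor>x powr u\<rfloor>}"
    then have "real n \<le> x powr u" by (simp add: le_nat_iff le_floor_iff)
    with xu n assms show "f_mult x n = 1" by (intro f_mult_eq_1) auto
  qed
  then have "mean_f x u = real (nat \<lfloor>x powr u\<rfloor>) / x powr u"
    by (simp add: mean_f_def)
  then have "mean_f x u - 1 = (real (nat \<lfloor>x powr u\<rfloor>) - x powr u) / x powr u"
    using assms by (simp add: diff_divide_distrib)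
  moreover have "\<bar>real (nat \<lfloor>x powr u\<rfloor>) - x powr u\<bar> \<le> 1" by simp linarith
  ultimately have "\<bar>mean_f x u - 1\<bar> \<le> 1 / x powr u"
    by (simp add: abs_divide divide_right_mono)
  then show ?thesis by (simp add: powr_minus_divide)
qed

text \<open>Allows one finite index set, fixed by U, to serve all smaller exponents
  simultaneously.\<close>

lemma log_le_iff_floor:
  assumes "x > 1" "s \<le> U"
  shows "{d\<in>{1..nat \<lfloor>x powr U\<rfloor>}. ln (real d) / ln x \<le> s} = {1..nat \<lfloor>x powr s\<rfloor>}"
proof -
  have floor: "d \<le> nat \<lfloor>y\<rfloor> \<longleftrightarrow> real d \<le> y" if "d \<ge> 1" for d and y :: real
    using that by (cases "y \<ge> 0") (auto simp: le_nat_iff le_floor_iff)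
  have "ln (real d) / ln x \<le> s \<longleftrightarrow> real d \<le> x powr s" if "d \<ge> 1" for d
  proof -
    have "ln (real d) / ln x \<le> s \<longleftrightarrow> ln (real d) \<le> ln (x powr s)"
      using assms by (simp add: pos_divide_le_eq ln_powr)
    also have "\<dots> \<longleftrightarrow> real d \<le> x powr s" using assms that by (intro ln_le_cancel_iff) auto
    finally show ?thesis .
  qed
  moreover have "x powr s \<le> x powr U" using assms by (intro powr_mono) auto
  ultimately show ?thesis using floor by auto
qed

text \<open>Mertens at y = x^s, divided by ln x. The error is uniform in s and vanishes as x
  grows.\<close>

lemma mertens_mass:
  assumes x: "x > 1" and s: "0 \<le> s" "s \<le> U"
  shows "\<bar>(\<Sum>d\<in>{d\<in>{1..nat \<lfloor>x powr U\<rfloor>}. ln (real d) / ln x \<le> s}. mangoldt d / (real d * ln x)) - s\<bar>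
    \<le> 5 / ln x"
proof -
  have L: "ln x > 0" using x by simp
  have "x powr s \<ge> 1" using x s by (simp add: ge_one_powr_ge_zero)
  from mertens[OF this] have "\<bar>(\<Sum>d=1..nat \<lfloor>x powr s\<rfloor>. mangoldt d / real d) - s * ln x\<bar> \<le> 5"
    using x by (simp add: ln_powr)
  then have "\<bar>(\<Sum>d=1..nat \<lfloor>x powr s\<rfloor>. mangoldt d / real d) - s * ln x\<bar> / ln x \<le> 5 / ln x"
    using L by (intro divide_right_mono) auto
  moreover have "\<bar>(\<Sum>d=1..nat \<lfloor>x powr s\<rfloor>. mangoldt d / real d) - s * ln x\<bar> / ln x
      = \<bar>((\<Sum>d=1..nat \<lfloor>x powr s\<rfloor>. mangoldt d / real d) - s * ln x) / ln x\<bar>"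
    using L by (simp add: abs_divide)
  moreover have "((\<Sum>d=1..nat \<lfloor>x powr s\<rfloor>. mangoldt d / real d) - s * ln x) / ln x
      = (\<Sum>d=1..nat \<lfloor>x powr s\<rfloor>. mangoldt d / (real d * ln x)) - s"
    using L by (simp add: diff_divide_distrib sum_divide_distrib)
  ultimately show ?thesis unfolding log_le_iff_floor[OF x s(2)] by (simp only:)
qed

text \<open>With y = x^u, divide the approximate logarithmic identity by y ln x. Since y/d = x^(u -
  t(d)), the inner sums become mean values, and the error is 1 / ln x. Replacing f_x(d) by
  \<open>\<rho>(t(d))\<close> changes nothing at primes and costs at most C / ln x
  elsewhere.\<close>

lemma mean_f_functional_equation:
  assumes x: "x > 1" and u: "0 \<le> u" "u \<le> U"
    and C: "\<And>N. (\<Sum>d\<in>{d\<in>{1..N}. \<not> prime d}. mangoldt d / real d) \<le> C"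
  shows "\<bar>u * mean_f x u - (\<Sum>d\<in>{d\<in>{1..nat \<lfloor>x powr U\<rfloor>}. ln (real d) / ln x \<le> u}.
      mangoldt d / (real d * ln x) * (dickman_rho (ln (real d) / ln x) * mean_f x (u - ln (real d) / ln x)))\<bar>
    \<le> (1 + C) / ln x"
proof -
  define L where "L = ln x"
  define y where "y = x powr u"
  define N where "N = nat \<lfloor>y\<rfloor>"
  let ?r = "\<lambda>d. dickman_rho (ln (real d) / L)"
  let ?F = "\<lambda>d. mean_f x (u - ln (real d) / L)"
  let ?w = "\<lambda>d. mangoldt d / (real d * L) :: real"
  have L: "L > 0" using x by (simp add: L_def)
  have y: "y \<ge> 1" using x u by (simp add: y_def ge_one_powr_ge_zero)
  have lny: "ln y = u * L" using x by (simp add: y_def L_def ln_powr)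
  have set: "{d\<in>{1..nat \<lfloor>x powr U\<rfloor>}. ln (real d) / L \<le> u} = {1..N}"
    unfolding N_def y_def L_def by (rule log_le_iff_floor[OF x u(2)])
  have powr_d: "x powr (u - ln (real d) / L) = y / real d" if "d \<ge> 1" for d
    using that x L by (simp add: powr_diff y_def) (simp add: powr_def L_def)
  have "\<bar>ln y * (\<Sum>n=1..N. f_mult x n)
      - (\<Sum>d=1..N. mangoldt d * f_mult x d * (\<Sum>n=1..nat \<lfloor>y / real d\<rfloor>. f_mult x n))\<bar> \<le> y"
    unfolding N_def using f_mult_mult f_mult_bounds y by (rule sum_completely_multiplicative_ln_approx)
  then have "\<bar>ln y * (\<Sum>n=1..N. f_mult x n)
      - (\<Sum>d=1..N. mangoldt d * f_mult x d * (\<Sum>n=1..nat \<lfloor>y / real d\<rfloor>. f_mult x n))\<bar> / (y * L) \<le> y / (y * L)"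
    using y L by (intro divide_right_mono) auto
  then have "\<bar>(ln y * (\<Sum>n=1..N. f_mult x n)
      - (\<Sum>d=1..N. mangoldt d * f_mult x d * (\<Sum>n=1..nat \<lfloor>y / real d\<rfloor>. f_mult x n))) / (y * L)\<bar> \<le> 1 / L"
    using y L by (simp add: abs_divide abs_mult)
  moreover have "(ln y * (\<Sum>n=1..N. f_mult x n)
      - (\<Sum>d=1..N. mangoldt d * f_mult x d * (\<Sum>n=1..nat \<lfloor>y / real d\<rfloor>. f_mult x n))) / (y * L)
      = u * mean_f x u - (\<Sum>d=1..N. ?w d * (f_mult x d * ?F d))"
  proof -
    have "(ln y * (\<Sum>n=1..N. f_mult x n)) / (y * L) = u * mean_f x u"
      using L by (simp add: lny mean_f_def y_def[symmetric] N_def)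
    moreover have "(\<Sum>d=1..N. mangoldt d * f_mult x d * (\<Sum>n=1..nat \<lfloor>y / real d\<rfloor>. f_mult x n)) / (y * L)
        = (\<Sum>d=1..N. ?w d * (f_mult x d * ?F d))"
      unfolding sum_divide_distrib
    proof (rule sum.cong[OF refl])
      fix d assume "d \<in> {1..N}"
      then have d: "d \<ge> 1" by simp
      show "mangoldt d * f_mult x d * (\<Sum>n=1..nat \<lfloor>y / real d\<rfloor>. f_mult x n) / (y * L)
          = ?w d * (f_mult x d * ?F d)"
        unfolding mean_f_def powr_d[OF d] using d y L by (simp add: mult_ac)
    qed
    ultimately show ?thesis by (simp add: diff_divide_distrib)
  qed
  ultimately have 1: "\<bar>u * mean_f x u - (\<Sum>d=1..N. ?w d * (f_mult x d * ?F d))\<bar> \<le> 1 / L" by (simp only:)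
  have "\<bar>(\<Sum>d=1..N. ?w d * (f_mult x d * ?F d)) - (\<Sum>d=1..N. ?w d * (?r d * ?F d))\<bar>
      = \<bar>\<Sum>d=1..N. ?w d * ((f_mult x d - ?r d) * ?F d)\<bar>"
    by (simp only: sum_subtractf[symmetric] left_diff_distrib right_diff_distrib)
  also have "\<dots> \<le> (\<Sum>d=1..N. \<bar>?w d * ((f_mult x d - ?r d) * ?F d)\<bar>)" by (rule sum_abs)
  also have "\<dots> \<le> (\<Sum>d=1..N. if \<not> prime d then ?w d else 0)"
  proof (rule sum_mono)
    fix d
    show "\<bar>?w d * ((f_mult x d - ?r d) * ?F d)\<bar> \<le> (if \<not> prime d then ?w d else 0)"
    proof (cases "prime d")
      case True
      then show ?thesis by (simp add: f_mult_prime L_def)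
    next
      case False
      have "\<bar>f_mult x d - ?r d\<bar> * \<bar>?F d\<bar> \<le> 1 * 1"
      proof (rule mult_mono)
        show "\<bar>f_mult x d - ?r d\<bar> \<le> 1"
          using f_mult_bounds[of x d] dickman_rho_nonneg[of "ln (real d) / L"]
            dickman_rho_le_1[of "ln (real d) / L"] by linarith
        show "\<bar>?F d\<bar> \<le> 1" using mean_f_bounds[of x "u - ln (real d) / L"] by linarith
      qed auto
      then have "?w d * (\<bar>f_mult x d - ?r d\<bar> * \<bar>?F d\<bar>) \<le> ?w d * 1"
        using L mangoldt_nonneg[of d] by (intro mult_left_mono) auto
      moreover have "\<bar>?w d\<bar> = ?w d" using L mangoldt_nonneg[of d] by simp
      ultimately show ?thesis using False by (simp only: abs_mult) simp
    qed
  qed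
  also have "\<dots> = (\<Sum>d\<in>{d\<in>{1..N}. \<not> prime d}. mangoldt d / real d) / L"
    by (simp add: sum.inter_filter[symmetric] sum_divide_distrib)
  also have "\<dots> \<le> C / L" using L C by (intro divide_right_mono) auto
  finally have "\<bar>u * mean_f x u - (\<Sum>d=1..N. ?w d * (?r d * ?F d))\<bar> \<le> 1 / L + C / L"
    using 1 by linarith
  then show ?thesis unfolding L_def[symmetric] set by (simp add: add_divide_distrib)
qed

text \<open>Uniform continuity of both factors on [0, U] gives a single h for all u <= U, so the
  mesh can be chosen before the point at which the equation is evaluated.\<close>

lemma convolution_oscillation:
  assumes "\<omega> > 0"
  obtains h where "h > 0" "\<And>u s r. 0 \<le> s \<Longrightarrow> s \<le> r \<Longrightarrow> r \<le> u \<Longrightarrow> u \<le> U \<Longrightarrow> r - s \<le> h \<Longrightarrow>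
    \<bar>dickman_rho s * Pi_fun (u - s) - dickman_rho r * Pi_fun (u - r)\<bar> \<le> \<omega>"
proof -
  have \<omega>2: "\<omega> / 2 > 0" using assms by simp
  have "uniformly_continuous_on {0..U} dickman_rho"
    by (intro compact_uniformly_continuous continuous_on_subset[OF continuous_dickman_rho]) auto
  from this[unfolded uniformly_continuous_on_def, rule_format, OF \<omega>2]
  obtain h1 where h1: "h1 > 0"
    "\<forall>s\<in>{0..U}. \<forall>r\<in>{0..U}. dist r s < h1 \<longrightarrow> dist (dickman_rho r) (dickman_rho s) < \<omega> / 2"
    by blast
  have "uniformly_continuous_on {0..U} Pi_fun"
    by (intro compact_uniformly_continuous continuous_on_subset[OF continuous_Pi_fun]) auto
  from this[unfolded uniformly_continuous_on_def, rule_format, OF \<omega>2]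
  obtain h2 where h2: "h2 > 0"
    "\<forall>s\<in>{0..U}. \<forall>r\<in>{0..U}. dist r s < h2 \<longrightarrow> dist (Pi_fun r) (Pi_fun s) < \<omega> / 2"
    by blast
  show ?thesis
  \<comment> \<open>Halving turns the weak bound on r - s into the strict one that uniform
    continuity asks for.\<close>
  proof (rule that[of "min h1 h2 / 2"])
    show "min h1 h2 / 2 > 0" using h1 h2 by simp
    fix u s r assume *: "0 \<le> s" "s \<le> r" "r \<le> u" "u \<le> U" "r - s \<le> min h1 h2 / 2"
    have "r - s < h1" "r - s < h2" using * h1(1) h2(1) by (auto simp: min_def split: if_splits)
    then have 1: "\<bar>dickman_rho s - dickman_rho r\<bar> < \<omega> / 2" and 2: "\<bar>Pi_fun (u - s) - Pi_fun (u - r)\<bar> < \<omega> / 2"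
      using h1(2)[rule_format, of r s] h2(2)[rule_format, of "u - r" "u - s"] * by (auto simp: dist_real_def)
    have "dickman_rho s * Pi_fun (u - s) - dickman_rho r * Pi_fun (u - r)
        = (dickman_rho s - dickman_rho r) * Pi_fun (u - s) + dickman_rho r * (Pi_fun (u - s) - Pi_fun (u - r))"
      by (simp add: algebra_simps)
    also have "\<bar>\<dots>\<bar> \<le> \<bar>dickman_rho s - dickman_rho r\<bar> * \<bar>Pi_fun (u - s)\<bar>
        + \<bar>dickman_rho r\<bar> * \<bar>Pi_fun (u - s) - Pi_fun (u - r)\<bar>"
      unfolding abs_mult[symmetric] by (rule abs_triangle_ineq)
    also have "\<dots> \<le> \<omega> / 2 * 1 + 1 * (\<omega> / 2)"
    proof (intro add_mono mult_mono)
      show "\<bar>Pi_fun (u - s)\<bar> \<le> 1" using Pi_fun_bounds[of "u - s"] * by auto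
      show "\<bar>dickman_rho r\<bar> \<le> 1" using dickman_rho_nonneg[of r] dickman_rho_le_1[of r] by auto
    qed (use 1 2 assms in auto)
    finally show "\<bar>dickman_rho s * Pi_fun (u - s) - dickman_rho r * Pi_fun (u - r)\<bar> \<le> \<omega>" by simp
  qed
qed

text \<open>The renewal inequality for E = |F - \<open>\<Pi>\<close>|: here \<open>\<tau>\<close> is
  the defect of F in its functional equation plus the error of \<open>\<Pi>\<close> in the
  discretized integral equation, and q = x^(-\<open>\<eta>\<close>) comes from the range
  [\<open>\<eta>\<close>, 1].\<close>

lemma mean_f_error_bound:
  assumes x: "x > 1" and U: "U \<ge> 1" and K: "K > 0" and \<omega>: "\<omega> \<ge> 0" and \<eta>: "0 \<le> \<eta>" "\<eta> \<le> 1"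
    and C: "\<And>N. (\<Sum>d\<in>{d\<in>{1..N}. \<not> prime d}. mangoldt d / real d) \<le> C"
    and osc: "\<And>u s r. 0 \<le> s \<Longrightarrow> s \<le> r \<Longrightarrow> r \<le> u \<Longrightarrow> u \<le> U \<Longrightarrow> r - s \<le> U / real K \<Longrightarrow>
      \<bar>dickman_rho s * Pi_fun (u - s) - dickman_rho r * Pi_fun (u - r)\<bar> \<le> \<omega>"
    and \<epsilon>: "\<epsilon> = 5 / ln x" and u: "1 \<le> u" "u \<le> U"
  shows "\<bar>mean_f x u - Pi_fun u\<bar> \<le> U * (((1 + C) / ln x + (\<epsilon> + 2 * \<omega> * U + real K * (2 * \<epsilon> * (1 + \<omega>))))
    + 3 * \<epsilon> + x powr (- \<eta>) * (U + \<epsilon>) + \<eta>)"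
proof (rule renewal_inequality_bound[where D = "{1..nat \<lfloor>x powr U\<rfloor>}"
      and w = "\<lambda>d. mangoldt d / (real d * ln x)" and t = "\<lambda>d. ln (real d) / ln x" and u = u and U = U
      and E = "\<lambda>u. \<bar>mean_f x u - Pi_fun u\<bar>"])
  let ?D = "{1..nat \<lfloor>x powr U\<rfloor>}"
  let ?w = "\<lambda>d. mangoldt d / (real d * ln x) :: real"
  let ?t = "\<lambda>d. ln (real d) / ln x"
  have L: "ln x > 0" using x by simp
  show w: "?w d \<ge> 0" for d using L mangoldt_nonneg[of d] by simp
  show t: "?t d \<ge> 0" if "d \<in> ?D" for d using L that by simp
  show mass: "\<bar>(\<Sum>d\<in>{d\<in>?D. ?t d \<le> s}. ?w d) - s\<bar> \<le> \<epsilon>" if "0 \<le> s" "s \<le> U" for s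
    unfolding \<epsilon> using that by (intro mertens_mass[OF x]) auto
  show "0 \<le> \<bar>mean_f x s - Pi_fun s\<bar> \<and> \<bar>mean_f x s - Pi_fun s\<bar> \<le> 1" if "0 \<le> s" "s \<le> U" for s
    using mean_f_bounds[of x s] Pi_fun_bounds[OF that(1)] by auto
  show "\<bar>mean_f x s - Pi_fun s\<bar> \<le> x powr (- \<eta>)" if "\<eta> \<le> s" "s \<le> 1" for s
  proof -
    have "Pi_fun s = 1" using is_Pi_eq_1[OF is_Pi_Pi_fun] that \<eta> by simp
    moreover have "x powr (- s) \<le> x powr (- \<eta>)" using that x by (intro powr_mono) auto
    ultimately show ?thesis using mean_f_near_1[OF x that(2)] by simp
  qed
  show "v * \<bar>mean_f x v - Pi_fun v\<bar>
      \<le> ((1 + C) / ln x + (\<epsilon> + 2 * \<omega> * U + real K * (2 * \<epsilon> * (1 + \<omega>))))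
        + (\<Sum>d\<in>{d\<in>?D. ?t d \<le> v}. ?w d * \<bar>mean_f x (v - ?t d) - Pi_fun (v - ?t d)\<bar>)"
    if v: "1 \<le> v" "v \<le> U" for v
  proof -
    let ?J = "{d\<in>?D. ?t d \<le> v}"
    let ?g = "\<lambda>s. dickman_rho s * Pi_fun (v - s)"
    \<comment> \<open>The cells are scaled to v, so that K of them fill [0, v] exactly; their length
      is still at most U / K, as the oscillation hypothesis requires.\<close>
    let ?h = "v / real K"
    have Kh: "real K * ?h = v" using K by simp
    have h: "0 \<le> ?h" "?h \<le> U / real K" using v K by (auto simp: divide_right_mono)
    have 1: "\<bar>v * mean_f x v - (\<Sum>d\<in>?J. ?w d * (dickman_rho (?t d) * mean_f x (v - ?t d)))\<bar> \<le> (1 + C) / ln x"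
      using v by (intro mean_f_functional_equation[OF x _ _ C]) auto
    have "\<bar>(\<Sum>d\<in>{d\<in>?D. ?t d \<le> real K * ?h}. ?w d * ?g (?t d)) - integral {0..real K * ?h} ?g\<bar>
      \<le> \<epsilon> + real K * (2 * \<omega> * ?h + 2 * \<epsilon> * (1 + \<omega>))"
    proof (rule weighted_sum_approx_integral)
      show "continuous_on {0..real K * ?h} ?g"
        unfolding Kh by (intro continuous_intros continuous_on_subset[OF continuous_dickman_rho]
            continuous_on_compose2[OF continuous_Pi_fun]) auto
      show "\<bar>?g s\<bar> \<le> 1" if "0 \<le> s" "s \<le> real K * ?h" for s
      proof -
        have "0 \<le> v - s" using that Kh by simp
        from Pi_fun_bounds[OF this] show ?thesis
          using dickman_rho_nonneg[of s] dickman_rho_le_1[of s] by (simp add: abs_mult mult_le_one)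
      qed
      show "\<bar>?g s - ?g r\<bar> \<le> \<omega>" if "0 \<le> s" "s \<le> r" "r \<le> real K * ?h" "r - s \<le> ?h" for s r
        using that h v Kh by (intro osc) auto
    qed (use w t mass v Kh h \<omega> in auto)
    then have "\<bar>(\<Sum>d\<in>?J. ?w d * ?g (?t d)) - v * Pi_fun v\<bar>
        \<le> \<epsilon> + real K * (2 * \<omega> * ?h + 2 * \<epsilon> * (1 + \<omega>))"
      unfolding Kh using integral_unique[OF Pi_fun_integral[of v]] v by simp
    also have "real K * (2 * \<omega> * ?h + 2 * \<epsilon> * (1 + \<omega>)) = 2 * \<omega> * (real K * ?h) + real K * (2 * \<epsilon> * (1 + \<omega>))"
      by (simp only: distrib_left mult.left_commute mult.assoc)
    also have "\<epsilon> + (2 * \<omega> * (real K * ?h) + real K * (2 * \<epsilon> * (1 + \<omega>))) \<le> \<epsilon> + 2 * \<omega> * U + real K * (2 * \<epsilon> * (1 + \<omega>))"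
      unfolding Kh using v \<omega> mult_left_mono[of v U "2 * \<omega>"] by simp
    finally have 2: "\<bar>(\<Sum>d\<in>?J. ?w d * ?g (?t d)) - v * Pi_fun v\<bar>
        \<le> \<epsilon> + 2 * \<omega> * U + real K * (2 * \<epsilon> * (1 + \<omega>))" .
    \<comment> \<open>Both sums have the same weights, so their difference is controlled by E itself
      once the factor \<open>\<rho>\<close> <= 1 is dropped.\<close>
    have "\<bar>(\<Sum>d\<in>?J. ?w d * (dickman_rho (?t d) * mean_f x (v - ?t d))) - (\<Sum>d\<in>?J. ?w d * ?g (?t d))\<bar>
        = \<bar>\<Sum>d\<in>?J. ?w d * (dickman_rho (?t d) * (mean_f x (v - ?t d) - Pi_fun (v - ?t d)))\<bar>"
      by (simp only: sum_subtractf[symmetric] right_diff_distrib)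
    also have "\<dots> \<le> (\<Sum>d\<in>?J. \<bar>?w d * (dickman_rho (?t d) * (mean_f x (v - ?t d) - Pi_fun (v - ?t d)))\<bar>)"
      by (rule sum_abs)
    also have "\<dots> \<le> (\<Sum>d\<in>?J. ?w d * \<bar>mean_f x (v - ?t d) - Pi_fun (v - ?t d)\<bar>)"
    proof (rule sum_mono)
      fix d
      have "dickman_rho (?t d) * \<bar>mean_f x (v - ?t d) - Pi_fun (v - ?t d)\<bar>
          \<le> 1 * \<bar>mean_f x (v - ?t d) - Pi_fun (v - ?t d)\<bar>"
        using dickman_rho_le_1 by (intro mult_right_mono) auto
      then show "\<bar>?w d * (dickman_rho (?t d) * (mean_f x (v - ?t d) - Pi_fun (v - ?t d)))\<bar>
          \<le> ?w d * \<bar>mean_f x (v - ?t d) - Pi_fun (v - ?t d)\<bar>"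
        unfolding abs_mult abs_of_nonneg[OF w] abs_of_nonneg[OF dickman_rho_nonneg]
        using w[of d] by (intro mult_left_mono) auto
    qed
    finally have "\<bar>v * mean_f x v - v * Pi_fun v\<bar>
      \<le> ((1 + C) / ln x + (\<epsilon> + 2 * \<omega> * U + real K * (2 * \<epsilon> * (1 + \<omega>))))
        + (\<Sum>d\<in>?J. ?w d * \<bar>mean_f x (v - ?t d) - Pi_fun (v - ?t d)\<bar>)"
      using 1 2 by linarith
    moreover have "\<bar>v * mean_f x v - v * Pi_fun v\<bar> = v * \<bar>mean_f x v - Pi_fun v\<bar>"
      using v by (simp add: right_diff_distrib[symmetric] abs_mult)
    ultimately show ?thesis by simp
  qed
qed (use U \<eta> u in auto)

text \<open>The order of choices matters: first \<open>\<omega>\<close> and \<open>\<eta>\<close>,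
  then the mesh through K, and x last, since the error contains K / ln x.\<close>

lemma mean_f_tendsto_Pi_fun_ge_1:
  assumes u: "u \<ge> 1"
  shows "((\<lambda>x. mean_f x u) \<longlongrightarrow> Pi_fun u) at_top"
proof (rule tendstoI)
  fix e :: real assume e: "e > 0"
  obtain C where C: "C \<ge> 0" "\<And>N. (\<Sum>d\<in>{d\<in>{1..N}. \<not> prime d}. mangoldt d / real d) \<le> C"
    using mangoldt_nonprime_sum_bounded by blast
  \<comment> \<open>The final bound is u (R + 2 \<open>\<omega>\<close> u + \<open>\<eta>\<close>).
    The choices make 2 \<open>\<omega>\<close> u equal to \<open>\<delta>\<close> and
    \<open>\<eta>\<close> at most \<open>\<delta>\<close>, and R drops below \<open>\<delta>\<close>
    for large x, so everything stays below 4 u \<open>\<delta>\<close> = e.\<close>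
  define \<delta> where "\<delta> = e / (4 * u)"
  define \<omega> where "\<omega> = \<delta> / (2 * u)"
  define \<eta> where "\<eta> = min 1 \<delta>"
  have pos: "\<delta> > 0" "\<omega> > 0" "\<eta> > 0" "\<eta> \<le> 1" "\<eta> \<le> \<delta>"
    using e u by (auto simp: \<delta>_def \<omega>_def \<eta>_def)
  obtain h where h: "h > 0" and osc: "\<And>v s r. 0 \<le> s \<Longrightarrow> s \<le> r \<Longrightarrow> r \<le> v \<Longrightarrow> v \<le> u \<Longrightarrow> r - s \<le> h \<Longrightarrow>
    \<bar>dickman_rho s * Pi_fun (v - s) - dickman_rho r * Pi_fun (v - r)\<bar> \<le> \<omega>"
    using convolution_oscillation[OF pos(2), of u] by metis
  obtain K where K: "u / h < real K" using reals_Archimedean2 by blast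
  have "u / h > 0" using u h by simp
  with K have K0: "K > 0" by (cases K) auto
  have Kh: "u / real K \<le> h" using K K0 h by (simp add: field_simps)
  \<comment> \<open>Collects the terms that vanish as x grows while \<open>\<omega>\<close>,
    \<open>\<eta>\<close> and K stay fixed.\<close>
  define R where "R x = (1 + C) / ln x + 5 / ln x + real K * (2 * (5 / ln x) * (1 + \<omega>))
    + 3 * (5 / ln x) + x powr (- \<eta>) * (u + 5 / ln x)" for x
  have lim0: "((\<lambda>x. c / ln x) \<longlongrightarrow> 0) at_top" for c :: real
    by (rule tendsto_divide_0[OF tendsto_const filterlim_at_top_imp_at_infinity[OF ln_at_top]])
  have limp: "((\<lambda>x. x powr (- \<eta>)) \<longlongrightarrow> 0) at_top"
    using pos by (intro tendsto_neg_powr filterlim_ident) auto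
  have "(R \<longlongrightarrow> 0 + 0 + real K * (2 * 0 * (1 + \<omega>)) + 3 * 0 + 0 * (u + 0)) at_top"
    unfolding R_def by (intro tendsto_add tendsto_mult tendsto_const lim0 limp)
  then have "(R \<longlongrightarrow> 0) at_top" by simp
  then have "\<forall>\<^sub>F x in at_top. R x < \<delta>" using pos by (intro order_tendstoD) auto
  with eventually_gt_at_top[of 1]
  show "\<forall>\<^sub>F x in at_top. dist (mean_f x u) (Pi_fun u) < e"
  proof eventually_elim
    case (elim x)
    have "\<bar>mean_f x u - Pi_fun u\<bar> \<le> u * (((1 + C) / ln x + (5 / ln x + 2 * \<omega> * u
      + real K * (2 * (5 / ln x) * (1 + \<omega>)))) + 3 * (5 / ln x) + x powr (- \<eta>) * (u + 5 / ln x) + \<eta>)"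
      using elim u pos K0 C(2) Kh by (intro mean_f_error_bound osc) auto
    also have "\<dots> = u * (R x + \<delta> + \<eta>)"
      using u by (simp add: R_def \<omega>_def)
    also have "\<dots> < u * (\<delta> + \<delta> + \<delta> + \<delta>)" using elim pos u by (intro mult_strict_left_mono) auto
    also have "\<dots> = e" using u by (simp add: \<delta>_def)
    finally show ?case by (simp add: dist_real_def)
  qed
qed

theorem mainTheorem4:
  fixes u :: real
  assumes "u > 0"
  shows "((\<lambda>x::real. (1 / x powr u) * (\<Sum>n\<in>{1..nat \<lfloor>x powr u\<rfloor>}. f_mult x n))
           \<longlongrightarrow> Pi_fun u) at_top"
proof -
  have "((\<lambda>x. mean_f x u) \<longlongrightarrow> Pi_fun u) at_top"
  proof (cases "u \<ge> 1")
    case True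
    then show ?thesis by (rule mean_f_tendsto_Pi_fun_ge_1)
  next
    case False
    \<comment> \<open>For 0 < u < 1 no recursion enters: the mean is within x^(-u) of 1, which is
      the value of \<open>\<Pi>\<close> there.\<close>
    have "((\<lambda>x. x powr (- u)) \<longlongrightarrow> 0) at_top"
      using assms by (intro tendsto_neg_powr filterlim_ident) auto
    moreover have "\<forall>\<^sub>F x in at_top. norm (mean_f x u - 1) \<le> x powr (- u)"
      using eventually_gt_at_top[of 1] by eventually_elim (use False mean_f_near_1 in auto)
    ultimately have "((\<lambda>x. mean_f x u - 1) \<longlongrightarrow> 0) at_top"
      by (rule Lim_null_comparison[rotated])
    then show ?thesis
      using False assms is_Pi_eq_1[OF is_Pi_Pi_fun, of u] by (simp add: LIM_zero_iff)
  qed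
  then show ?thesis unfolding mean_f_def .
qed

end
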